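(* Let $L_0$ and $L_1$ be two distinct rays in $\mathbb{C}$ emanating from the origin and let $\mathcal{F}$ be the family of all functions $f$ holomorphic in the unit disk $\mathbb{D}$ for which all zeros of $f$ lie on $L_0$ and all $1$-points of $f$ lie on $L_1$. Then $\mathcal{F}$ is normal in $\mathbb{D}\setminus\{0\}$.
   Context: $\mathbb{D}=\{z\in\mathbb{C}: |z|<1\}$. A $1$-point of $f$ is a point $z$ in the domain of $f$ with $f(z)=1$. A family of holomorphic functions is normal in an open set $U$ if every sequence in the family has a subsequence which converges locally uniformly in $U$ with respect to the spherical metric (the constant limit $\infty$ is allowed). *)

theory Defs
  imports "HOL-Analysis.Analysis"
begin

section \<open>The Riemann sphere with the spherical metric\<close>

datatype riemann_sphere = Finite complex | Infty

text \<open>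
  Inverse of the stereographic projection, onto the unit sphere of \<open>\<complex> \<times> \<real>\<close>, with \<open>Infty\<close>
  corresponding to the north pole.
\<close>

fun stereo :: "riemann_sphere \<Rightarrow> complex \<times> real" where
  "stereo (Finite z) =
     (of_real (2 / (1 + (cmod z)\<^sup>2)) * z, ((cmod z)\<^sup>2 - 1) / ((cmod z)\<^sup>2 + 1))"
| "stereo Infty = (0, 1)"

lemma norm_stereo [simp]: "norm (stereo p) = 1"
proof (cases p)
  case (Finite z)
  have pos: "1 + (cmod z)\<^sup>2 > 0"
    by (simp add: add_pos_nonneg)
  have "(norm (stereo p))\<^sup>2 =
      (2 / (1 + (cmod z)\<^sup>2) * cmod z)\<^sup>2 + (((cmod z)\<^sup>2 - 1) / ((cmod z)\<^sup>2 + 1))\<^sup>2"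
    using pos by (simp add: Finite norm_prod_def norm_mult norm_divide power_mult_distrib power_divide
        del: of_real_divide)
  also have "\<dots> = (4 * (cmod z)\<^sup>2 + ((cmod z)\<^sup>2 - 1)\<^sup>2) / (1 + (cmod z)\<^sup>2)\<^sup>2"
    by (simp add: power_mult_distrib power_divide add_divide_distrib add.commute)
  also have "4 * (cmod z)\<^sup>2 + ((cmod z)\<^sup>2 - 1)\<^sup>2 = (1 + (cmod z)\<^sup>2)\<^sup>2"
    by (simp add: power2_eq_square algebra_simps)
  also have "(1 + (cmod z)\<^sup>2)\<^sup>2 / (1 + (cmod z)\<^sup>2)\<^sup>2 = 1"
    using pos by simp
  finally show ?thesis
    by (simp add: power2_eq_1_iff)
       (metis abs_norm_cancel abs_1 abs_minus_cancel)
qed (simp add: norm_prod_def)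

lemma stereo_eq_iff [simp]: "stereo p = stereo q \<longleftrightarrow> p = q"
proof
  have snd_Finite: "snd (stereo (Finite z)) = 1 - 2 / (1 + (cmod z)\<^sup>2)" for z
    by (simp add: divide_simps) (smt (verit) zero_le_power2)
  have pos: "1 + (cmod z)\<^sup>2 > 0" for z
    by (simp add: add_pos_nonneg)
  assume eq: "stereo p = stereo q"
  show "p = q"
  proof (cases p; cases q)
    fix z w assume pq: "p = Finite z" "q = Finite w"
    have "2 / (1 + (cmod z)\<^sup>2) = 2 / (1 + (cmod w)\<^sup>2)"
      using eq snd_Finite[of z] snd_Finite[of w] pq by simp
    moreover have "of_real (2 / (1 + (cmod z)\<^sup>2)) * z = of_real (2 / (1 + (cmod w)\<^sup>2)) * w"
      using eq pq by simp
    moreover have "2 / (1 + (cmod w)\<^sup>2) \<noteq> 0"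
      using pos[of w] by simp
    ultimately show ?thesis
      using pq by (metis mult_left_cancel of_real_eq_0_iff)
  next
    fix z assume "p = Finite z" "q = Infty"
    then show ?thesis
      using eq snd_Finite[of z] pos[of z] by (metis diff_eq_eq add_cancel_right_right
          divide_eq_0_iff less_irrefl zero_neq_numeral snd_conv stereo.simps(2))
  next
    fix z assume "p = Infty" "q = Finite z"
    then show ?thesis
      using eq snd_Finite[of z] pos[of z] by (metis diff_eq_eq add_cancel_right_right
          divide_eq_0_iff less_irrefl zero_neq_numeral snd_conv stereo.simps(2))
  qed simp
qed simp

lemma arccos_inner_triangle:
  fixes a b c :: "'a::real_inner"
  assumes "norm a = 1" "norm b = 1" "norm c = 1"
  shows "arccos (a \<bullet> c) \<le> arccos (a \<bullet> b) + arccos (b \<bullet> c)"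
proof (cases "arccos (a \<bullet> b) + arccos (b \<bullet> c) \<le> pi")
  case True
  define x where "x = a \<bullet> b"
  define y where "y = b \<bullet> c"
  have bnd: "\<bar>u \<bullet> v\<bar> \<le> 1" if "norm u = 1" "norm v = 1" for u v :: 'a
    using Cauchy_Schwarz_ineq2[of u v] that by simp
  have x: "-1 \<le> x" "x \<le> 1" and y: "-1 \<le> y" "y \<le> 1" and ac: "-1 \<le> a \<bullet> c" "a \<bullet> c \<le> 1"
    using bnd[of a b] bnd[of b c] bnd[of a c] assms by (auto simp: x_def y_def)
  have sq: "a \<bullet> a = 1" "b \<bullet> b = 1" "c \<bullet> c = 1"
    using assms by (auto simp: norm_eq_1)
  have "norm (a - x *\<^sub>R b) = sqrt (1 - x\<^sup>2)" "norm (c - y *\<^sub>R b) = sqrt (1 - y\<^sup>2)"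
    unfolding norm_eq_sqrt_inner
    by (simp_all add: inner_diff_left inner_diff_right sq x_def y_def inner_commute power2_eq_square)
  moreover have "(a - x *\<^sub>R b) \<bullet> (c - y *\<^sub>R b) = a \<bullet> c - x * y"
    by (simp add: inner_diff_left inner_diff_right sq x_def y_def inner_commute)
  ultimately have "x * y - sqrt (1 - x\<^sup>2) * sqrt (1 - y\<^sup>2) \<le> a \<bullet> c"
    using Cauchy_Schwarz_ineq2[of "a - x *\<^sub>R b" "c - y *\<^sub>R b"] by simp
  then have "cos (arccos x + arccos y) \<le> cos (arccos (a \<bullet> c))"
    using x y ac by (simp add: cos_add sin_arccos_abs cos_arccos sin_arccos_abs abs_le_iff)
  moreover have "0 \<le> arccos x + arccos y"
    using arccos_lbound x y by (simp add: add_nonneg_nonneg)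
  ultimately show ?thesis
    using True ac cos_mono_le_eq[of "arccos x + arccos y" "arccos (a \<bullet> c)"]
      arccos_lbound[of "a \<bullet> c"] arccos_ubound[of "a \<bullet> c"]
    by (simp add: x_def y_def)
next
  case False
  then show ?thesis
    using arccos_ubound[of "a \<bullet> c"] Cauchy_Schwarz_ineq2[of a c] assms by (simp add: abs_le_iff)
qed

text \<open>
  The spherical distance is the length of the great-circle arc, i.e. the distance induced by the
  Riemannian metric with density \<open>2 |dz| / (1 + |z|\<^sup>2)\<close>.
\<close>

instantiation riemann_sphere :: metric_space
begin

definition dist_riemann_sphere :: "riemann_sphere \<Rightarrow> riemann_sphere \<Rightarrow> real" where
  "dist_riemann_sphere p q = arccos (stereo p \<bullet> stereo q)"

definition uniformity_riemann_sphere :: "(riemann_sphere \<times> riemann_sphere) filter" where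
  "uniformity_riemann_sphere = (INF e\<in>{0<..}. principal {(p, q). dist p q < e})"

definition open_riemann_sphere :: "riemann_sphere set \<Rightarrow> bool" where
  "open_riemann_sphere U \<longleftrightarrow> (\<forall>p\<in>U. \<forall>\<^sub>F (p', q) in uniformity. p' = p \<longrightarrow> q \<in> U)"

instance
proof
  fix p q r :: riemann_sphere
  have bnd: "\<bar>stereo p \<bullet> stereo q\<bar> \<le> 1"
    using Cauchy_Schwarz_ineq2[of "stereo p" "stereo q"] by simp
  show "dist p q = 0 \<longleftrightarrow> p = q"
  proof
    assume "dist p q = 0"
    then have "stereo p \<bullet> stereo q = 1"
      using bnd cos_arccos[of "stereo p \<bullet> stereo q"] by (simp add: dist_riemann_sphere_def abs_le_iff)
    moreover have "stereo u \<bullet> stereo u = 1" for u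
      using norm_stereo[of u] by (simp only: norm_eq_1)
    ultimately have "(stereo p - stereo q) \<bullet> (stereo p - stereo q) = 0"
      by (simp add: inner_diff_left inner_diff_right inner_commute)
    then show "p = q"
      by simp
  next
    assume "p = q"
    then show "dist p q = 0"
      by (simp add: dist_riemann_sphere_def flip: power2_norm_eq_inner)
  qed
  show "dist p q \<le> dist p r + dist q r"
    using arccos_inner_triangle[of "stereo p" "stereo r" "stereo q"]
    by (simp add: dist_riemann_sphere_def inner_commute)
qed (simp_all add: uniformity_riemann_sphere_def open_riemann_sphere_def)

end


section \<open>Normal families\<close>

definition locally_uniform_limit ::
    "'a::topological_space set \<Rightarrow> (nat \<Rightarrow> 'a \<Rightarrow> 'b::metric_space) \<Rightarrow> ('a \<Rightarrow> 'b) \<Rightarrow> bool" where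
  "locally_uniform_limit U f g \<longleftrightarrow>
     (\<forall>x\<in>U. \<exists>V. open V \<and> x \<in> V \<and> uniform_limit (U \<inter> V) f g sequentially)"

text \<open>
  The limit function takes values in the sphere, so that the constant limit \<open>Infty\<close> is allowed.
\<close>

definition normal_family_on :: "complex set \<Rightarrow> (complex \<Rightarrow> complex) set \<Rightarrow> bool" where
  "normal_family_on U \<F> \<longleftrightarrow>
     (\<forall>f :: nat \<Rightarrow> complex \<Rightarrow> complex. (\<forall>n. f n \<in> \<F>) \<longrightarrow>
        (\<exists>r g. strict_mono (r :: nat \<Rightarrow> nat) \<and>
           locally_uniform_limit U (\<lambda>n z. Finite (f (r n) z)) g))"


section \<open>Rays\<close>

definition ray_from_origin :: "complex set \<Rightarrow> bool" where
  "ray_from_origin L \<longleftrightarrow> (\<exists>c. c \<noteq> 0 \<and> L = {t *\<^sub>R c |t. t \<ge> 0})"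

end

theory Submission
  imports Defs "HOL-Complex_Analysis.Complex_Analysis" "HOL-Library.Diagonal_Subsequence"
begin

text \<open>
  Composing with the exponential map turns the rays into horizontal lines. Near a zero line the
  functions \<open>g = 1 - f\<close> have no zeros and take the value 1 only on the line, so \<open>g = exp (2 \<pi> \<i> k)\<close>
  where \<open>k\<close> is an integer only on the line. Montel's theorem applied to \<open>k / M\<close> with integers \<open>M\<close>
  shows that \<open>k\<close> grows at most polynomially towards the line, hence \<open>k\<close> is bounded near the centre
  in terms of its values at two points off the line. If these values stay bounded there is a
  convergent subsequence; otherwise the rescaled functions \<open>k / A\<close> converge to a function that is
  real only on the line, so that \<open>Im k\<close> tends to \<open>+\<infinity>\<close> on one side and to \<open>-\<infinity>\<close> on the other, and
  \<open>g\<close> tends to 0 and \<open>\<infinity>\<close>, respectively. Thus a failure of normality at a zero line forces \<open>f\<close> to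
  tend to 1 on one of the two strips between the lines and to \<open>\<infinity>\<close> on the other one. At a line of
  1-points the same dichotomy for \<open>f\<close> itself only allows the pair of limits 0 and \<open>\<infinity>\<close>.
\<close>

section \<open>Holomorphic functions with real preimages of the integers\<close>

text \<open>The obstacle is that \<open>k\<close> may take integer values on the line, so Montel's
  theorem works on either side of it but not across it. The one-sided bounds blow up at the line; it
  is the polynomial rate that allows them to be joined, because a circle meets the line in two
  points only and a polynomial with zeros there absorbs the blow-up. The contradiction is global.
  Modulo the period there are only two strips, and each of them borders both a zero line and the
  line \<open>Im z = \<beta>\<close> of 1-points. Limits found on the two sides of a zero line
  therefore spread through the strips and face each other again across
  \<open>Im z = \<beta>\<close>, where the pair 1 and \<infinity> is impossible. Distinctness of the
  rays makes both strips nonempty. Lines of 1-points need no separate argument, since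
  \<open>1 - f\<close> exchanges the two kinds of lines. The origin has to be left out: for a
  nonzero \<open>c\<close> on the second ray the functions \<open>n * z / c\<close> belong to the
  family, and they are not normal at 0.\<close>

lemma omit_integers_step:
  obtains C :: real where "C \<ge> 1"
    "\<And>k z d w. \<lbrakk>d > 0; k holomorphic_on ball z d; \<And>u. u \<in> ball z d \<Longrightarrow> k u \<notin> \<int>; dist z w \<le> 3/4 * d\<rbrakk>
       \<Longrightarrow> 1 + cmod (k w) \<le> C * (1 + cmod (k z))"
proof -
  define X where "X = {h. h holomorphic_on ball 0 1 \<and> (\<forall>z \<in> ball (0::complex) 1. h z \<noteq> 0 \<and> h z \<noteq> (1::complex))}"
  \<comment> \<open>This is Schottky's theorem: \<open>B\<close> is fixed before \<open>k\<close>,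
    \<open>z\<close> and \<open>d\<close>, so a single \<open>C\<close> serves all of them.
    Estimating \<open>1 + cmod (k w)\<close> instead of \<open>cmod (k w)\<close> makes the bound
    multiplicative and hence iterable along chains of disks.\<close>
  obtain B where B: "\<And>h z. \<lbrakk>h \<in> {h \<in> X. norm (h 0) \<le> 1}; z \<in> cball 0 (3/4)\<rbrakk> \<Longrightarrow> norm (h z) \<le> B"
  proof (rule GPicard3[of "ball 0 1" 0 "{h \<in> X. norm (h 0) \<le> 1}" X "cball 0 (3/4)"])
    show "cball (0::complex) (3/4) \<subseteq> ball 0 1" by (simp add: cball_subset_ball_iff)
  qed (auto simp: X_def)
  show ?thesis
  proof (rule that[of "1 + \<bar>B\<bar>"])
    fix k z d w
    assume d: "d > 0" and k: "k holomorphic_on ball z d" and nz: "\<And>u. u \<in> ball z d \<Longrightarrow> k u \<notin> \<int>"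
      and w: "dist z w \<le> 3/4 * d"
    \<comment> \<open>Dividing by an integer \<open>M\<close> of the size of \<open>k z\<close> yields a function omitting 0 and 1.\<close>
    define M where "M = max 1 \<lceil>cmod (k z)\<rceil>"
    have M: "real_of_int M \<ge> 1" "cmod (k z) \<le> of_int M" "of_int M \<le> 1 + cmod (k z)"
      using norm_ge_zero[of "k z"] le_of_int_ceiling[of "cmod (k z)"]
      by (auto simp: M_def max_def) (use of_int_ceiling_le_add_one[of "cmod (k z)"] in linarith)
    have inb: "z + of_real d * u \<in> ball z d" if "u \<in> ball 0 1" for u
      using that d by (simp add: dist_norm norm_mult)
    define h where "h = (\<lambda>u. k (z + of_real d * u) / of_int M)"
    have "h holomorphic_on ball 0 1"
      unfolding h_def using inb M
      by (intro holomorphic_intros holomorphic_on_compose_gen[OF _ k, unfolded o_def]) auto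
    moreover have "h u \<noteq> 0 \<and> h u \<noteq> 1" if "u \<in> ball 0 1" for u
      using nz[OF inb[OF that]] M by (auto simp: h_def divide_simps)
    moreover have "cmod (h 0) \<le> 1"
      using M by (simp add: h_def norm_divide divide_simps)
    ultimately have "h \<in> {h \<in> X. norm (h 0) \<le> 1}"
      by (auto simp: X_def)
    moreover have "(w - z) / of_real d \<in> cball 0 (3/4)"
      using w d by (simp add: dist_norm norm_divide divide_simps norm_minus_commute)
    ultimately have "cmod (h ((w - z) / of_real d)) \<le> B"
      by (rule B)
    moreover have "h ((w - z) / of_real d) = k w / of_int M"
      using d by (simp add: h_def)
    ultimately have "cmod (k w) \<le> B * of_int M"
      using M by (simp add: norm_divide divide_simps)
    also have "\<dots> \<le> \<bar>B\<bar> * (1 + cmod (k z))"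
      using M by (intro mult_mono) auto
    finally show "1 + cmod (k w) \<le> (1 + \<bar>B\<bar>) * (1 + cmod (k z))"
      using norm_ge_zero[of "k z"] by (simp only: distrib_right mult_1)
  qed simp
qed

text \<open>Going down from height \<open>2 * y\<close> to height \<open>y\<close> costs one factor
  \<open>C\<close>, and about log2 (1 / y) halvings reach height \<open>y\<close>, so the total cost
  is a power of \<open>1 / y\<close>; every \<open>p\<close> with \<open>C < 2 ^ p\<close> is an
  admissible exponent. The reference point \<open>\<i> / 8\<close> is that low because it has to lie
  in the disk of radius 3/16 on which \<open>k\<close> is finally bounded.\<close>

lemma polynomial_growth_upper:
  obtains C :: real and p :: nat where "C \<ge> 1" "p \<ge> 1"
    "\<And>k z. \<lbrakk>k holomorphic_on ball 0 1; \<And>u. \<lbrakk>u \<in> ball 0 1; Im u > 0\<rbrakk> \<Longrightarrow> k u \<notin> \<int>;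
        cmod z \<le> 1/4; Im z > 0\<rbrakk>
       \<Longrightarrow> cmod (k z) * Im z ^ p \<le> C * (1 + cmod (k (\<i> / 8)))"
proof -
  obtain C :: real where C: "C \<ge> 1" and step:
    "\<And>k z d w. \<lbrakk>d > 0; k holomorphic_on ball z d; \<And>u. u \<in> ball z d \<Longrightarrow> k u \<notin> \<int>; dist z w \<le> 3/4 * d\<rbrakk>
       \<Longrightarrow> 1 + cmod (k w) \<le> C * (1 + cmod (k z))"
    using omit_integers_step by metis
  obtain p where p: "C < 2 ^ p"
    using real_arch_pow[of 2 C] by auto
  have C4: "C ^ 4 \<ge> 1"
    using C by (simp add: one_le_power)
  have p1: "p \<ge> 1"
    using p C by (cases p) auto
  show ?thesis
  proof (rule that[OF C4 p1])
    fix k z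
    assume hol: "k holomorphic_on ball 0 1" and nz: "\<And>u. \<lbrakk>u \<in> ball 0 1; Im u > 0\<rbrakk> \<Longrightarrow> k u \<notin> \<int>"
      and z: "cmod z \<le> 1/4" "Im z > 0"
    define P where "P = (\<lambda>z. 1 + cmod (k z))"
    have step': "P w \<le> C * P v" if "cmod v + d \<le> 1" "d \<le> Im v" "d > 0" "dist v w \<le> 3/4 * d" for v w d
      unfolding P_def
    proof (rule step[of d k v w])
      have sub: "ball v d \<subseteq> ball 0 1"
        using that(1) by (simp add: ball_subset_ball_iff)
      then show "k holomorphic_on ball v d"
        using hol holomorphic_on_subset by blast
      show "k u \<notin> \<int>" if u: "u \<in> ball v d" for u
      proof (rule nz)
        show "u \<in> ball 0 1" using sub u by blast
        show "Im u > 0"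
          using u \<open>d \<le> Im v\<close> abs_Im_le_cmod[of "v - u"] by (simp add: dist_norm)
      qed
    qed (use that in auto)
    \<comment> \<open>The chain passes through the heights 1/5 and 3/10. A disk of radius
      \<open>s\<close> about height \<open>s\<close> permits an upward step to at most
      \<open>7/4 * s\<close>.\<close>
    have base: "P (\<i> / 2) \<le> C ^ 3 * P (\<i> / 8)"
    proof -
      have imul: "P (\<i> * of_real t) \<le> C * P (\<i> * of_real s)"
        if "0 < s" "s \<le> 1/2" "s \<le> t" "t \<le> 7/4 * s" for s t
      proof (rule step'[of _ s])
        have "\<i> * complex_of_real s - \<i> * of_real t = \<i> * of_real (s - t)"
          by (simp add: algebra_simps)
        then have "dist (\<i> * complex_of_real s) (\<i> * of_real t) = \<bar>s - t\<bar>"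
          by (simp only: dist_norm norm_mult norm_of_real norm_ii mult_1)
        then show "dist (\<i> * complex_of_real s) (\<i> * of_real t) \<le> 3/4 * s"
          using that by simp
      qed (use that in \<open>simp_all add: norm_mult\<close>)
      have "P (\<i> / 2) \<le> C * P (\<i> * of_real (3/10))" using imul[of "3/10" "1/2"] by simp
      also have "\<dots> \<le> C * (C * P (\<i> * of_real (1/5)))"
        using imul[of "1/5" "3/10"] C by (intro mult_left_mono) auto
      also have "\<dots> \<le> C * (C * (C * P (\<i> / 8)))"
        using imul[of "1/8" "1/5"] C by (intro mult_left_mono) auto
      finally show ?thesis by (simp add: power3_eq_cube mult.assoc)
    qed
    \<comment> \<open>\<open>n\<close> counts halvings below height 1/4. For \<open>n = 0\<close>
      all points in question lie within 3/8 of \<open>\<i> / 2\<close>, which is three quarters of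
      the radius 1/2.\<close>
    have claim: "P (Complex x y) \<le> C ^ n * (C * P (\<i> / 2))"
      if "\<bar>x\<bar> \<le> 1/4" "1/4 * (1/2) ^ n \<le> y" "y \<le> 1/2" for n x y
      using that
    proof (induction n arbitrary: y)
      case 0
      have "cmod (\<i> / 2 - Complex x y) \<le> 3/8"
      proof (rule power2_le_imp_le)
        have "x\<^sup>2 \<le> (1/4)\<^sup>2" "(1/2 - y)\<^sup>2 \<le> (1/4)\<^sup>2"
          using 0 by (auto intro!: power2_le_iff_abs_le[THEN iffD2] simp: abs_le_iff)
        moreover have "(cmod (\<i> / 2 - Complex x y))\<^sup>2 = x\<^sup>2 + (1/2 - y)\<^sup>2"
          by (simp add: cmod_power2)
        ultimately show "(cmod (\<i> / 2 - Complex x y))\<^sup>2 \<le> (3/8)\<^sup>2"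
          by (simp add: power_divide)
      qed simp
      then show ?case
        using step'[of "\<i>/2" "1/2" "Complex x y"] by (simp add: dist_norm norm_divide)
    next
      case (Suc n)
      have P0: "C * P (\<i> / 2) \<ge> 0" using C by (simp add: P_def)
      have Cn: "C ^ n \<le> C ^ Suc n" using C by (intro power_increasing) auto
      have y0: "y > 0"
        using Suc.prems(2) by (smt (verit) zero_less_power half_gt_zero_iff mult_pos_pos zero_less_divide_1_iff)
      show ?case
      proof (cases "y \<ge> 1/4")
        case True
        have "(1/2::real) ^ n \<le> 1" by (simp add: power_le_one)
        then have "P (Complex x y) \<le> C ^ n * (C * P (\<i> / 2))"
          using Suc True by auto
        also have "\<dots> \<le> C ^ Suc n * (C * P (\<i> / 2))"
          using Cn P0 by (rule mult_right_mono)
        finally show ?thesis .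
      next
        case False
        have *: "P (Complex x (2*y)) \<le> C ^ n * (C * P (\<i> / 2))"
          using Suc False by auto
        have "P (Complex x y) \<le> C * P (Complex x (2*y))"
        \<comment> \<open>Three quarters of this radius is \<open>y\<close>, the distance of the two
          points, while the radius is still smaller than the height \<open>2 * y\<close> of the
          centre.\<close>
        proof (rule step'[of _ "4/3 * y"])
          have "cmod (Complex x (2*y)) \<le> 3/5"
          proof (rule power2_le_imp_le)
            have "x\<^sup>2 \<le> (1/4)\<^sup>2" "(2*y)\<^sup>2 \<le> (1/2)\<^sup>2"
              using Suc.prems(1) False y0 power_mono[of "2*y" "1/2" 2]
              by (auto intro!: power2_le_iff_abs_le[THEN iffD2])
            moreover have "(cmod (Complex x (2*y)))\<^sup>2 = x\<^sup>2 + (2*y)\<^sup>2"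
              by (simp only: cmod_power2 complex.sel)
            ultimately show "(cmod (Complex x (2*y)))\<^sup>2 \<le> (3/5)\<^sup>2"
              by (simp add: power_divide)
          qed simp
          then show "cmod (Complex x (2*y)) + 4/3 * y \<le> 1"
            using False by simp
          have "Complex x (2*y) - Complex x y = \<i> * of_real y"
            by (simp add: complex_eq_iff)
          then show "dist (Complex x (2 * y)) (Complex x y) \<le> 3/4 * (4/3 * y)"
            using y0 by (simp add: dist_norm norm_mult)
        qed (use y0 in auto)
        also have "\<dots> \<le> C * (C ^ n * (C * P (\<i> / 2)))"
          using * C by (intro mult_left_mono) auto
        finally show ?thesis by (simp add: mult.assoc)
      qed
    qed
    define y where "y = Im z"
    have y: "y > 0" "y \<le> 1/4" "\<bar>Re z\<bar> \<le> 1/4"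
      using z abs_Im_le_cmod[of z] abs_Re_le_cmod[of z] by (auto simp: y_def)
    obtain m where "(1/2) ^ m < 4 * y"
      using real_arch_pow_inv[of "4 * y" "1/2"] y by auto
    then have ex: "1/4 * (1/2) ^ m \<le> y" by simp
    \<comment> \<open>Minimality of \<open>n\<close> gives \<open>2 ^ n * y \<le> 1\<close>, so that
      \<open>C ^ n \<le> (2 ^ p) ^ n\<close> is at most \<open>1 / y ^ p\<close>.\<close>
    define n where "n = (LEAST n. 1/4 * (1/2) ^ n \<le> y)"
    have n: "1/4 * (1/2) ^ n \<le> y"
      unfolding n_def by (rule LeastI[of _ m]) (rule ex)
    have "2 ^ n * y \<le> 1"
    proof (cases n)
      case (Suc l)
      then have "\<not> 1/4 * (1/2) ^ l \<le> y"
        using not_less_Least[of l "\<lambda>n. 1/4 * (1/2) ^ n \<le> y"] by (simp add: n_def)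
      then have "y \<le> 1/4 * (1/2) ^ l" by simp
      then have "2 ^ l * y \<le> 2 ^ l * (1/4 * (1/2) ^ l)"
        by (intro mult_left_mono) auto
      also have "\<dots> = 1/4" by (simp add: power_divide)
      finally show ?thesis using Suc by simp
    qed (use y in auto)
    then have "(2 ^ n * y) ^ p \<le> 1"
      using y by (intro power_le_one) auto
    moreover have "C ^ n \<le> (2 ^ p) ^ n"
      using p C by (intro power_mono) auto
    then have "C ^ n * y ^ p \<le> (2 ^ p) ^ n * y ^ p"
      using y by (intro mult_right_mono) auto
    moreover have "(2 ^ p) ^ n * y ^ p = (2 ^ n * y) ^ p"
      by (simp add: power_mult_distrib mult.commute flip: power_mult)
    ultimately have *: "C ^ n * y ^ p \<le> 1" by simp
    have "P z \<le> C ^ n * (C * P (\<i> / 2))"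
      using claim[of "Re z" n y] n y by (simp add: y_def)
    also have "\<dots> \<le> C ^ n * (C * (C ^ 3 * P (\<i> / 8)))"
      using base C by (intro mult_left_mono) auto
    finally have "P z * y ^ p \<le> C ^ n * (C * (C ^ 3 * P (\<i> / 8))) * y ^ p"
      using y by (intro mult_right_mono) auto
    also have "\<dots> = (C ^ n * y ^ p) * (C ^ 4 * P (\<i> / 8))"
      by (simp add: eval_nat_numeral)
    also have "\<dots> \<le> 1 * (C ^ 4 * P (\<i> / 8))"
      using * C by (intro mult_right_mono) (auto simp: P_def)
    finally have "P z * y ^ p \<le> C ^ 4 * P (\<i> / 8)" by simp
    moreover have "cmod (k z) * y ^ p \<le> P z * y ^ p"
      using y by (intro mult_right_mono) (auto simp: P_def)
    ultimately show "cmod (k z) * Im z ^ p \<le> C ^ 4 * (1 + cmod (k (\<i> / 8)))"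
      by (simp add: y_def P_def)
  qed
qed

text \<open>What matters is that the bound is linear in the values at two points, one in each half
  disk: divided by the size of these values, any sequence of such \<open>k\<close> is uniformly
  bounded on the smaller disk, however large the values are.\<close>

lemma integer_preimages_real_bound:
  obtains C :: real where
    "\<And>k z. \<lbrakk>k holomorphic_on ball 0 1; \<And>u. \<lbrakk>u \<in> ball 0 1; k u \<in> \<int>\<rbrakk> \<Longrightarrow> Im u = 0; cmod z \<le> 3/16\<rbrakk>
       \<Longrightarrow> cmod (k z) \<le> C * (1 + cmod (k (\<i> / 8)) + cmod (k (- \<i> / 8)))"
proof -
  obtain C :: real and p :: nat where C: "C \<ge> 1" and p: "p \<ge> 1" and growth:
    "\<And>k z. \<lbrakk>k holomorphic_on ball 0 1; \<And>u. \<lbrakk>u \<in> ball 0 1; Im u > 0\<rbrakk> \<Longrightarrow> k u \<notin> \<int>;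
        cmod z \<le> 1/4; Im z > 0\<rbrakk>
       \<Longrightarrow> cmod (k z) * Im z ^ p \<le> C * (1 + cmod (k (\<i> / 8)))"
    using polynomial_growth_upper by metis
  show ?thesis
  proof (rule that[of "(256 / 7) ^ p * C"])
    fix k z
    assume hol: "k holomorphic_on ball 0 1"
      and real: "\<And>u. \<lbrakk>u \<in> ball 0 1; k u \<in> \<int>\<rbrakk> \<Longrightarrow> Im u = 0" and z: "cmod z \<le> 3/16"
    define A where "A = 1 + cmod (k (\<i> / 8)) + cmod (k (- \<i> / 8))"
    \<comment> \<open>On the circle \<open>|z| = 1/4\<close> the factor has modulus \<open>(|Im z| / 2) ^ p\<close>, which absorbs the
      polynomial growth of \<open>k\<close> towards the real line.\<close>
    define q where "q = (\<lambda>z. k z * (z\<^sup>2 - 1/16) ^ p)"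
    have A: "A \<ge> 1" by (simp add: A_def)
    have upper: "cmod (k v) * Im v ^ p \<le> C * A" if "cmod v \<le> 1/4" "Im v > 0" for v
    proof -
      have "cmod (k v) * Im v ^ p \<le> C * (1 + cmod (k (\<i> / 8)))"
        using real that by (intro growth hol) force+
      also have "\<dots> \<le> C * A"
        using C by (intro mult_left_mono) (auto simp: A_def)
      finally show ?thesis .
    qed
    have lower: "cmod (k v) * (- Im v) ^ p \<le> C * A" if "cmod v \<le> 1/4" "Im v < 0" for v
    proof -
      have "cmod (k (- (- v))) * Im (- v) ^ p \<le> C * (1 + cmod (k (- (\<i> / 8))))"
      proof (rule growth[of "\<lambda>z. k (- z)"])
        show "(\<lambda>z. k (- z)) holomorphic_on ball 0 1"
          by (intro holomorphic_on_compose_gen[OF _ hol, unfolded o_def] holomorphic_intros) auto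
        show "k (- u) \<notin> \<int>" if "u \<in> ball 0 1" "Im u > 0" for u
          using real[of "- u"] that by auto
      qed (use that in auto)
      also have "\<dots> \<le> C * A"
        using C by (intro mult_left_mono) (auto simp: A_def)
      finally show ?thesis by simp
    qed
    have qhol: "q holomorphic_on ball 0 1"
      unfolding q_def by (intro holomorphic_intros hol)
    have sub: "cball (0::complex) (1/4) \<subseteq> ball 0 1"
      by (simp add: cball_subset_ball_iff)
    have "cmod (q z) \<le> C * A"
    proof (rule maximum_modulus_frontier[of q "cball 0 (1/4)"])
      show "q holomorphic_on interior (cball 0 (1/4))"
        using qhol sub by (auto intro: holomorphic_on_subset)
      show "continuous_on (closure (cball 0 (1/4))) q"
        using holomorphic_on_imp_continuous_on[OF qhol] sub by (simp add: continuous_on_subset)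
      show "z \<in> cball 0 (1/4)" using z by simp
      fix v assume "v \<in> frontier (cball (0::complex) (1/4))"
      \<comment> \<open>On this circle 1/16 equals \<open>v * cnj v\<close>, so the factor becomes
        \<open>v * (v - cnj v)\<close>, a multiple of \<open>Im v\<close>.\<close>
      then have v: "cmod v = 1/4" by simp
      have "v\<^sup>2 - 1/16 = v\<^sup>2 - v * cnj v"
        by (simp only: complex_norm_square[symmetric] v) (simp add: power_divide)
      also have "\<dots> = v * (2 * \<i> * of_real (Im v))"
        by (simp add: complex_eq_iff power2_eq_square algebra_simps)
      finally have "cmod (v\<^sup>2 - 1/16) = \<bar>Im v\<bar> / 2"
        using v by (simp add: norm_mult)
      then have "cmod (q v) = cmod (k v) * (\<bar>Im v\<bar> / 2) ^ p"
        by (simp only: q_def norm_mult norm_power)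
      also have "\<dots> \<le> cmod (k v) * \<bar>Im v\<bar> ^ p"
        by (intro mult_left_mono power_mono) auto
      also have "\<dots> \<le> C * A"
        \<comment> \<open>Neither estimate covers the two points with \<open>Im v = 0\<close>; there
          the right factor vanishes because \<open>p \<ge> 1\<close>.\<close>
        using upper[of v] lower[of v] v A C p
        by (cases "Im v" "0::real" rule: linorder_cases) (auto simp: zero_power)
      finally show "cmod (q v) \<le> C * A" .
    qed simp
    \<comment> \<open>7/256 is 1/16 - (3/16)^2, the least modulus of \<open>z^2 - 1/16\<close> for
      \<open>cmod z \<le> 3/16\<close>.\<close>
    moreover have "(7/256) ^ p \<le> cmod (z\<^sup>2 - 1/16) ^ p"
    proof (rule power_mono)
      have "cmod (z\<^sup>2) \<le> (3/16)\<^sup>2"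
        using z by (simp only: norm_power) (intro power_mono, auto)
      moreover have "cmod (1/16 :: complex) - cmod (z\<^sup>2) \<le> cmod (1/16 - z\<^sup>2)"
        by (rule norm_triangle_ineq2)
      ultimately show "7/256 \<le> cmod (z\<^sup>2 - 1/16)"
        by (simp add: norm_minus_commute power2_eq_square)
    qed simp
    then have "cmod (k z) * (7/256) ^ p \<le> cmod (q z)"
      by (simp add: q_def norm_mult norm_power mult_left_mono)
    ultimately have "cmod (k z) * (7/256) ^ p \<le> C * A" by simp
    then have "(256/7) ^ p * (cmod (k z) * (7/256) ^ p) \<le> (256/7) ^ p * (C * A)"
      by (intro mult_left_mono) auto
    moreover have "(256/7) ^ p * (cmod (k z) * (7/256) ^ p) = cmod (k z)"
      by (simp flip: power_mult_distrib add: mult.left_commute)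
    ultimately show "cmod (k z) \<le> (256 / 7) ^ p * C * (1 + cmod (k (\<i> / 8)) + cmod (k (- \<i> / 8)))"
      by (simp add: A_def mult.assoc)
  qed
qed

section \<open>Zero-free functions whose 1-points lie on a line\<close>

lemma infinite_subsequence:
  assumes "infinite {n. P n}"
  obtains r :: "nat \<Rightarrow> nat" where "strict_mono r" "\<And>n. P (r n)"
  using infinite_enumerate[OF assms] by auto

text \<open>At a base point \<open>w\<close> either \<open>f n\<close> or its inverse has modulus at
  most 1 for infinitely many \<open>n\<close>, and inversion preserves the omission of 0 and 1, so
  Schottky's bound makes one of the two sequences locally bounded. When the inverses converge,
  Hurwitz's theorem leaves two possibilities: a zero-free limit, which can be inverted back, or the
  limit 0, which means escape to infinity.\<close>

lemma Montel_omitting_01: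
  fixes f :: "nat \<Rightarrow> complex \<Rightarrow> complex"
  assumes S: "open S" "connected S"
    and hol: "\<And>n. f n holomorphic_on S"
    and omit: "\<And>n z. z \<in> S \<Longrightarrow> f n z \<noteq> 0 \<and> f n z \<noteq> 1"
  obtains r :: "nat \<Rightarrow> nat" and h where "strict_mono r" "h holomorphic_on S"
      "\<And>K. \<lbrakk>compact K; K \<subseteq> S\<rbrakk> \<Longrightarrow> uniform_limit K (\<lambda>n. f (r n)) h sequentially"
  | r :: "nat \<Rightarrow> nat" where "strict_mono r"
      "\<And>K M. \<lbrakk>compact K; K \<subseteq> S\<rbrakk> \<Longrightarrow> \<forall>\<^sub>F n in sequentially. \<forall>z\<in>K. M \<le> cmod (f (r n) z)"
proof (cases "S = {}")
  case True
  show ?thesis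
    by (rule that(1)[of id "\<lambda>_. 0"]) (auto simp: True strict_mono_def)
next
  case False
  then obtain w where w: "w \<in> S" by blast
  have bounded: "\<exists>r h. strict_mono r \<and> h holomorphic_on S \<and>
      (\<forall>K. compact K \<longrightarrow> K \<subseteq> S \<longrightarrow> uniform_limit K (\<lambda>n. F (r n)) h sequentially)"
    if holF: "\<And>n. F n holomorphic_on S" and F01: "\<And>n z. z \<in> S \<Longrightarrow> F n z \<noteq> 0 \<and> F n z \<noteq> 1"
      and Fw: "\<And>n. cmod (F n w) \<le> 1" for F :: "nat \<Rightarrow> complex \<Rightarrow> complex"
  proof -
    have "\<exists>B. \<forall>h\<in>range F. \<forall>z\<in>K. cmod (h z) \<le> B" if K: "compact K" "K \<subseteq> S" for K
    proof (rule GPicard3[OF S w order_refl[of "range F"] _ _ _ K])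
      fix B assume "\<And>h z. \<lbrakk>h \<in> range F; z \<in> K\<rbrakk> \<Longrightarrow> cmod (h z) \<le> B"
      then show ?thesis by blast
    qed (use holF F01 Fw in auto)
    then obtain h r where "h holomorphic_on S" "strict_mono (r :: nat \<Rightarrow> nat)"
      "\<And>K. \<lbrakk>compact K; K \<subseteq> S\<rbrakk> \<Longrightarrow> uniform_limit K (F \<circ> r) h sequentially"
      using Montel[of S "range F" F] S(1) holF by (metis (no_types, lifting) order_refl imageE)
    then show ?thesis
      unfolding o_def by blast
  qed
  have "infinite {n. cmod (f n w) \<le> 1} \<or> infinite {n. cmod (f n w) \<ge> 1}"
  proof (rule ccontr)
    assume "\<not> ?thesis"
    then have "finite ({n. cmod (f n w) \<le> 1} \<union> {n. cmod (f n w) \<ge> 1})" by simp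
    moreover have "{n. cmod (f n w) \<le> 1} \<union> {n. cmod (f n w) \<ge> 1} = UNIV" by auto
    ultimately show False by simp
  qed
  then show ?thesis
  proof
    assume "infinite {n. cmod (f n w) \<le> 1}"
    then obtain r :: "nat \<Rightarrow> nat" where r: "strict_mono r" "\<And>n. cmod (f (r n) w) \<le> 1"
      using infinite_subsequence[of "\<lambda>n. cmod (f n w) \<le> 1"] by blast
    then obtain s :: "nat \<Rightarrow> nat" and h where s: "strict_mono s" "h holomorphic_on S"
      "\<And>K. \<lbrakk>compact K; K \<subseteq> S\<rbrakk> \<Longrightarrow> uniform_limit K (\<lambda>n. f (r (s n))) h sequentially"
      using bounded[of "\<lambda>n. f (r n)"] hol omit by blast
    show ?thesis
      by (rule that(1)[of "r \<circ> s" h]) (use r s in \<open>auto intro: strict_mono_o\<close>)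
  next
    assume "infinite {n. cmod (f n w) \<ge> 1}"
    then obtain r :: "nat \<Rightarrow> nat" where r: "strict_mono r" "\<And>n. cmod (f (r n) w) \<ge> 1"
      using infinite_subsequence[of "\<lambda>n. cmod (f n w) \<ge> 1"] by blast
    define F where "F = (\<lambda>n z. inverse (f (r n) z))"
    have F: "F n holomorphic_on S" "z \<in> S \<Longrightarrow> F n z \<noteq> 0 \<and> F n z \<noteq> 1" "cmod (F n w) \<le> 1" for n z
      using hol omit r(2) unfolding F_def
      by (auto intro!: holomorphic_intros simp: norm_inverse inverse_le_1_iff)
    then obtain s :: "nat \<Rightarrow> nat" and h where s: "strict_mono s" "h holomorphic_on S"
      and lim: "\<And>K. \<lbrakk>compact K; K \<subseteq> S\<rbrakk> \<Longrightarrow> uniform_limit K (\<lambda>n. F (s n)) h sequentially"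
      using bounded[of F] by blast
    show ?thesis
    proof (cases "\<exists>z\<in>S. h z = 0")
      case True
      have "h constant_on S"
        using Hurwitz_no_zeros[OF S F(1) s(2) lim] F(2) True by blast
      then have h0: "h z = 0" if "z \<in> S" for z
        using True that by (auto simp: constant_on_def)
      show ?thesis
      proof (rule that(2)[of "r \<circ> s"])
        fix K M assume K: "compact K" "K \<subseteq> S"
        have "\<forall>\<^sub>F n in sequentially. \<forall>z\<in>K. dist (F (s n) z) (h z) < inverse (\<bar>M\<bar> + 1)"
          using lim[OF K] by (rule uniform_limitD) simp
        then show "\<forall>\<^sub>F n in sequentially. \<forall>z\<in>K. M \<le> cmod (f ((r \<circ> s) n) z)"
        proof eventually_elim
          case (elim n)
          show ?case
          proof
            fix z assume z: "z \<in> K"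
            then have "inverse (cmod (f (r (s n)) z)) < inverse (\<bar>M\<bar> + 1)"
              using elim h0[of z] K by (auto simp: F_def simp flip: norm_inverse dest!: subsetD bspec)
            moreover have "cmod (f (r (s n)) z) > 0"
              using omit z K by auto
            ultimately have "\<bar>M\<bar> + 1 < cmod (f (r (s n)) z)"
              by (smt (verit) inverse_less_iff_less)
            then show "M \<le> cmod (f ((r \<circ> s) n) z)" by simp
          qed
        qed
      qed (use r s in \<open>auto intro: strict_mono_o\<close>)
    next
      case False
      show ?thesis
      proof (rule that(1)[of "r \<circ> s" "\<lambda>z. inverse (h z)"])
        show "(\<lambda>z. inverse (h z)) holomorphic_on S"
          using False s(2) by (intro holomorphic_intros) auto
        fix K assume K: "compact K" "K \<subseteq> S"
        show "uniform_limit K (\<lambda>n. f ((r \<circ> s) n)) (\<lambda>z. inverse (h z)) sequentially"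
        proof (cases "K = {}")
          case False
          have "continuous_on K (\<lambda>z. cmod (h z))"
            using s(2) K by (intro continuous_intros) (auto intro: holomorphic_on_imp_continuous_on holomorphic_on_subset)
          then obtain z0 where z0: "z0 \<in> K" "\<And>z. z \<in> K \<Longrightarrow> cmod (h z0) \<le> cmod (h z)"
            using continuous_attains_inf[OF K(1) False] by blast
          have "uniform_limit K (\<lambda>n z. inverse (F (s n) z)) (\<lambda>z. inverse (h z)) sequentially"
            by (rule uniform_lim_inverse[OF lim[OF K], of "cmod (h z0)", unfolded o_def])
               (use z0 K \<open>\<not> (\<exists>z\<in>S. h z = 0)\<close> in auto)
          then show ?thesis by (simp add: F_def)
        qed simp
      qed (use r s in \<open>auto intro: strict_mono_o\<close>)
    qed
  qed
qed

text \<open>This replaces spherical convergence inside the proof: finite uniform limits and uniform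
  escape to infinity are the two outcomes of Montel's theorem, they imply uniform convergence in the
  spherical metric, and they are easily carried over from \<open>1 - f\<close> to
  \<open>f\<close>.\<close>

definition sphere_convergent_on :: "complex set \<Rightarrow> (nat \<Rightarrow> complex \<Rightarrow> complex) \<Rightarrow> bool" where
  "sphere_convergent_on V f \<longleftrightarrow>
     (\<exists>h. uniform_limit V f h sequentially) \<or>
     (\<forall>M. \<forall>\<^sub>F n in sequentially. \<forall>z\<in>V. M \<le> cmod (f n z))"

text \<open>Pointwise limits are enough, since Montel's theorem in the strips recovers locally
  uniform convergence along a subsequence.\<close>

definition zero_infinity_limits :: "complex set \<Rightarrow> complex set \<Rightarrow> (nat \<Rightarrow> complex \<Rightarrow> complex) \<Rightarrow> bool" where
  "zero_infinity_limits S T f \<longleftrightarrow>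
     (\<forall>z\<in>S. (\<lambda>n. f n z) \<longlonglongrightarrow> 0) \<and> (\<forall>z\<in>T. filterlim (\<lambda>n. f n z) at_infinity sequentially)"

lemma uniform_limit_imp_sphere_convergent:
  "uniform_limit V f h sequentially \<Longrightarrow> sphere_convergent_on V f"
  by (auto simp: sphere_convergent_on_def)

section \<open>Signs of imaginary parts and limits of the rescaled functions\<close>

lemma open_imp_nonreal:
  assumes "open W" "w \<in> W"
  shows "\<exists>z\<in>W. Im z \<noteq> 0"
proof -
  obtain e where e: "e > 0" "cball w e \<subseteq> W"
    using assms open_contains_cball by blast
  have "w + of_real e * \<i> \<in> W"
    using e by (intro subsetD[OF e(2)]) (simp add: dist_norm norm_mult)
  moreover have "Im w \<noteq> 0 \<or> Im (w + of_real e * \<i>) \<noteq> 0"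
    using e(1) by auto
  ultimately show ?thesis using assms(2) by blast
qed

lemma connected_constant_sign:
  fixes \<phi> :: "'a::topological_space \<Rightarrow> real"
  assumes "connected T" "continuous_on T \<phi>" "\<And>z. z \<in> T \<Longrightarrow> \<phi> z \<noteq> 0" "a \<in> T" "b \<in> T" "\<phi> a > 0"
  shows "\<phi> b > 0"
proof (rule ccontr)
  assume "\<not> \<phi> b > 0"
  moreover have "connected (\<phi> ` T)"
    using assms(1,2) by (rule connected_continuous_image[rotated])
  ultimately have "0 \<in> \<phi> ` T"
    using assms connectedD_interval[of "\<phi> ` T" "\<phi> b" "\<phi> a" 0] by auto
  then show False using assms(3) by auto
qed

text \<open>Since the set \<open>\<int> / A n\<close> becomes dense in the real line, Hurwitz's theorem passes the
  hypothesis on integer values of \<open>k n\<close> to all real values of the limit.\<close>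

lemma rescaled_limit_real_preimages:
  fixes k :: "nat \<Rightarrow> complex \<Rightarrow> complex" and A :: "nat \<Rightarrow> real"
  assumes S: "open S" "convex S"
    and hol: "\<And>n. k n holomorphic_on S" and K: "K holomorphic_on S" "\<not> K constant_on S"
    and real: "\<And>n u. \<lbrakk>u \<in> S; k n u \<in> \<int>\<rbrakk> \<Longrightarrow> Im u = 0"
    and A: "filterlim A at_top sequentially" "\<And>n. A n > 0"
    and lim: "\<And>X. \<lbrakk>compact X; X \<subseteq> S\<rbrakk> \<Longrightarrow> uniform_limit X (\<lambda>n z. k n z / of_real (A n)) K sequentially"
    and z: "z \<in> S" "Im (K z) = 0"
  shows "Im z = 0"
proof (rule ccontr)
  assume nr: "Im z \<noteq> 0"
  \<comment> \<open>The part of \<open>S\<close> on the side of \<open>z\<close>: it is convex, and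
    no \<open>k n\<close> takes an integer value in it.\<close>
  define T where "T = {u \<in> S. 0 < Im z * Im u}"
  have T: "open T" "convex T" "z \<in> T" "T \<subseteq> S"
  proof -
    have eq: "T = S \<inter> {u. (\<i> * of_real (Im z)) \<bullet> u > 0}"
      by (auto simp: T_def inner_complex_def)
    show "open T" "convex T"
      unfolding eq using S by (auto intro!: open_Int convex_Int open_halfspace_gt convex_halfspace_gt)
    show "z \<in> T" "T \<subseteq> S"
      using z nr by (auto simp: T_def zero_less_mult_iff linorder_neq_iff)
  qed
  define t where "t = Re (K z)"
  have Kz: "K z = of_real t"
    using z by (simp add: t_def complex_eq_iff)
  \<comment> \<open>A zero of \<open>k n / A n - c n\<close> is an integer value of
    \<open>k n\<close>, so subtracting the rounded number \<open>c n\<close> instead of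
    \<open>t\<close> yields functions without zeros in \<open>T\<close>. The limit is the same,
    since the rounding error is at most \<open>1 / A n\<close>.\<close>
  define c where "c = (\<lambda>n. complex_of_real (of_int \<lfloor>t * A n\<rfloor> / A n))"
  have ct: "c \<longlonglongrightarrow> of_real t"
    unfolding c_def
  proof (rule tendsto_of_real, rule LIM_zero_cancel, rule tendsto_rabs_zero_cancel,
      rule tendsto_sandwich[of "\<lambda>_. 0" _ _ "\<lambda>n. 1 / A n"])
    show "(\<lambda>n. 1 / A n) \<longlonglongrightarrow> 0"
      using A(1) by (intro tendsto_divide_0[OF tendsto_const] filterlim_at_top_imp_at_infinity)
    show "\<forall>\<^sub>F n in sequentially. \<bar>of_int \<lfloor>t * A n\<rfloor> / A n - t\<bar> \<le> 1 / A n"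
    proof (rule always_eventually, rule allI)
      fix n
      have "\<bar>of_int \<lfloor>t * A n\<rfloor> - t * A n\<bar> \<le> 1" by linarith
      moreover have "of_int \<lfloor>t * A n\<rfloor> / A n - t = (of_int \<lfloor>t * A n\<rfloor> - t * A n) / A n"
        using A(2)[of n] by (simp add: field_simps)
      ultimately show "\<bar>of_int \<lfloor>t * A n\<rfloor> / A n - t\<bar> \<le> 1 / A n"
        using A(2)[of n] by (simp add: divide_right_mono)
    qed
  qed auto
  have "K z - of_real t \<noteq> 0"
  proof (rule Hurwitz_no_zeros[of T "\<lambda>n u. k n u / of_real (A n) - c n" "\<lambda>u. K u - of_real t"])
    show "(\<lambda>u. k n u / of_real (A n) - c n) holomorphic_on T" for n
      using A(2)[of n] holomorphic_on_subset[OF hol T(4)] by (intro holomorphic_intros) auto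
    show "(\<lambda>u. K u - of_real t) holomorphic_on T"
      using holomorphic_on_subset[OF K(1) T(4)] by (intro holomorphic_intros)
    show "uniform_limit X (\<lambda>n u. k n u / of_real (A n) - c n) (\<lambda>u. K u - of_real t) sequentially"
      if "compact X" "X \<subseteq> T" for X
      using lim[of X] that T(4) ct by (intro uniform_limit_intros) (auto simp: uniform_limit_iff tendsto_iff)
    show "k n u / of_real (A n) - c n \<noteq> 0" if "u \<in> T" for n u
    proof
      assume "k n u / of_real (A n) - c n = 0"
      then have "k n u = of_int \<lfloor>t * A n\<rfloor>"
        using A(2)[of n] by (simp add: c_def)
      then have "Im u = 0" using real[of u n] that T(4) by auto
      then show False using that by (simp add: T_def)
    qed
    show "\<not> (\<lambda>u. K u - of_real t) constant_on T"
    proof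
      assume "(\<lambda>u. K u - of_real t) constant_on T"
      then have *: "K u = K z" if "u \<in> T" for u
        using that T(3) unfolding constant_on_def by (metis diff_add_cancel)
      have "K u = K z" if "u \<in> S" for u
        using T(3) by (intro analytic_continuation_open[OF T(1) S(1) _ convex_connected[OF S(2)] T(4) K(1) _ * that]) auto
      then show False using K(2) by (auto simp: constant_on_def)
    qed
  qed (use T in \<open>auto intro: convex_connected\<close>)
  then show False using Kz by simp
qed

text \<open>1-points serve as an anchor. If they are absent from the disk of radius 1/8, Montel's
  theorem applies to \<open>g\<close> directly. Otherwise \<open>k\<close> can be normalized to
  vanish at one of them, which together with the scaling by \<open>A\<close> prevents the rescaled
  limit from being constant; a nonconstant limit is open and so its imaginary part takes both
  signs.\<close>

lemma dichotomy_unit_ball: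
  fixes g :: "nat \<Rightarrow> complex \<Rightarrow> complex"
  assumes hol: "\<And>n. g n holomorphic_on ball 0 1"
    and nz: "\<And>n z. z \<in> ball 0 1 \<Longrightarrow> g n z \<noteq> 0"
    and one: "\<And>n z. \<lbrakk>z \<in> ball 0 1; g n z = 1\<rbrakk> \<Longrightarrow> Im z = 0"
  obtains r :: "nat \<Rightarrow> nat" where "strict_mono r"
    "sphere_convergent_on (ball 0 (1/16)) (\<lambda>n. g (r n)) \<or>
     zero_infinity_limits {z \<in> ball 0 (1/16). Im z > 0} {z \<in> ball 0 (1/16). Im z < 0} (\<lambda>n. g (r n)) \<or>
     zero_infinity_limits {z \<in> ball 0 (1/16). Im z < 0} {z \<in> ball 0 (1/16). Im z > 0} (\<lambda>n. g (r n))"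
proof (cases "infinite {n. \<forall>z\<in>ball 0 (1/8). g n z \<noteq> 1}")
  case True
  then obtain r :: "nat \<Rightarrow> nat" where r: "strict_mono r" "\<And>n. \<forall>z\<in>ball 0 (1/8). g (r n) z \<noteq> 1"
    using infinite_subsequence[of "\<lambda>n. \<forall>z\<in>ball 0 (1/8). g n z \<noteq> 1"] by blast
  have sub: "ball (0::complex) (1/8) \<subseteq> ball 0 1" "cball (0::complex) (1/16) \<subseteq> ball 0 (1/8)"
    by (simp_all add: cball_subset_ball_iff ball_subset_ball_iff)
  have "g (r n) holomorphic_on ball 0 (1/8)"
    "z \<in> ball 0 (1/8) \<Longrightarrow> g (r n) z \<noteq> 0 \<and> g (r n) z \<noteq> 1" for n z
    using r(2) hol nz sub(1) by (auto intro: holomorphic_on_subset)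
  then show ?thesis
  proof (rule Montel_omitting_01[OF open_ball connected_ball])
    fix s h assume s: "strict_mono s" and
      lim: "\<And>K. \<lbrakk>compact K; K \<subseteq> ball 0 (1/8)\<rbrakk> \<Longrightarrow> uniform_limit K (\<lambda>n. g (r (s n))) h sequentially"
    have "sphere_convergent_on (ball 0 (1/16)) (\<lambda>n. g (r (s n)))"
      by (rule uniform_limit_imp_sphere_convergent[OF uniform_limit_on_subset[OF lim[OF compact_cball sub(2)]]]) simp
    then show thesis
      using that[of "r \<circ> s"] r(1) s by (auto intro: strict_mono_o)
  next
    fix s assume s: "strict_mono s" and
      lim: "\<And>K M. \<lbrakk>compact K; K \<subseteq> ball 0 (1/8)\<rbrakk> \<Longrightarrow> \<forall>\<^sub>F n in sequentially. \<forall>z\<in>K. M \<le> cmod (g (r (s n)) z)"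
    have "sphere_convergent_on (ball 0 (1/16)) (\<lambda>n. g (r (s n)))"
      unfolding sphere_convergent_on_def
    proof (intro disjI2 allI)
      fix M
      show "\<forall>\<^sub>F n in sequentially. \<forall>z\<in>ball 0 (1/16). M \<le> cmod (g (r (s n)) z)"
        using lim[OF compact_cball sub(2), of M] by eventually_elim auto
    qed
    then show thesis
      using that[of "r \<circ> s"] r(1) s by (auto intro: strict_mono_o)
  qed
next
  case False
  have "infinite {n. \<exists>z\<in>ball 0 (1/8). g n z = 1}"
  proof
    assume "finite {n. \<exists>z\<in>ball 0 (1/8). g n z = 1}"
    then have "finite ({n. \<forall>z\<in>ball 0 (1/8). g n z \<noteq> 1} \<union> {n. \<exists>z\<in>ball 0 (1/8). g n z = 1})"
      using False by simp
    moreover have "\<dots> = UNIV" by auto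
    ultimately show False by simp
  qed
  then obtain r0 :: "nat \<Rightarrow> nat" where r0: "strict_mono r0" "\<And>n. \<exists>z\<in>ball 0 (1/8). g (r0 n) z = 1"
    using infinite_subsequence[of "\<lambda>n. \<exists>z\<in>ball 0 (1/8). g n z = 1"] by blast
  then obtain x where x: "\<And>n. x n \<in> ball 0 (1/8)" "\<And>n. g (r0 n) (x n) = 1"
    by metis
  have x1: "x n \<in> ball 0 1" for n
    using x(1)[of n] by simp
  have "\<exists>k. k holomorphic_on ball 0 1 \<and> k (x n) = 0 \<and>
      (\<forall>z\<in>ball 0 1. g (r0 n) z = exp (2 * of_real pi * \<i> * k z))" for n
  proof -
    obtain l where l: "l holomorphic_on ball 0 1" "\<And>z. z \<in> ball 0 1 \<Longrightarrow> g (r0 n) z = exp (l z)"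
      using simply_connected_eq_holomorphic_log[OF open_ball] convex_imp_simply_connected[OF convex_ball] hol nz
      by metis
    \<comment> \<open>Since \<open>g (r0 n) (x n) = 1\<close>, the number \<open>l (x n)\<close> is
      a period of exp; subtracting it selects the branch that vanishes at
      \<open>x n\<close>.\<close>
    have "exp (l z - l (x n)) = g (r0 n) z" if "z \<in> ball 0 1" for z
      using l(2)[OF that] l(2)[OF x1[of n]] x(2)[of n] by (simp add: exp_diff)
    then show ?thesis
      using l(1) by (intro exI[of _ "\<lambda>z. (l z - l (x n)) / (2 * of_real pi * \<i>)"])
        (auto intro!: holomorphic_intros)
  qed
  then obtain k where k: "\<And>n. k n holomorphic_on ball 0 1" "\<And>n. k n (x n) = 0"
      "\<And>n z. z \<in> ball 0 1 \<Longrightarrow> g (r0 n) z = exp (2 * of_real pi * \<i> * k n z)"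
    by metis
  have norm_g: "cmod (g (r0 n) z) = exp (2 * pi * (- Im (k n z)))" if "z \<in> ball 0 1" for n z
    using k(3)[OF that] by (simp add: norm_exp_eq_Re)
  have k_real: "Im u = 0" if u: "u \<in> ball 0 1" "k n u \<in> \<int>" for n u
  proof (rule one[OF u(1)])
    obtain m where "k n u = of_int m" using u(2) by (elim Ints_cases)
    then show "g (r0 n) u = 1"
      using k(3)[OF u(1), of n] exp_integer_2pi[of "of_int m"] by (simp add: mult_ac)
  qed
  \<comment> \<open>The points \<open>\<i> / 8\<close> and \<open>- \<i> / 8\<close> will lie in
    \<open>S\<close>, so the limit of \<open>k n / A n\<close> controls the values that define
    \<open>A n\<close>. The summand 1 makes division by \<open>A n\<close> harmless.\<close>
  define A where "A = (\<lambda>n. 1 + cmod (k n (\<i> / 8)) + cmod (k n (- \<i> / 8)))"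
  have A1: "A n \<ge> 1" for n by (simp add: A_def)
  obtain C where C: "\<And>n z. cmod z \<le> 3/16 \<Longrightarrow> cmod (k n z) \<le> C * A n"
    using integer_preimages_real_bound k(1) k_real unfolding A_def by metis
  define S where "S = ball (0::complex) (3/16)"
  have S: "open S" "convex S" "connected S" "S \<subseteq> ball 0 1" "cball 0 (1/8) \<subseteq> S" "cball 0 (1/16) \<subseteq> S"
    "ball 0 (1/16) \<subseteq> S"
    by (auto simp: S_def cball_subset_ball_iff ball_subset_ball_iff)
  have C0: "C \<ge> 0"
    using C[of 0 0] A1[of 0] by (smt (verit) norm_ge_zero norm_zero zero_le_mult_iff divide_nonneg_nonneg)
  show ?thesis
  proof (cases "\<exists>M. infinite {n. A n \<le> M}")
    case True
    then obtain M where "infinite {n. A n \<le> M}" by blast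
    then obtain r1 :: "nat \<Rightarrow> nat" where r1: "strict_mono r1" "\<And>n. A (r1 n) \<le> M"
      using infinite_subsequence[of "\<lambda>n. A n \<le> M"] by blast
    define G where "G = (\<lambda>n. g (r0 (r1 n)))"
    have bound: "cmod (G n z) \<le> exp (2 * pi * (C * M))" if "z \<in> S" for n z
    proof -
      have "- Im (k (r1 n) z) \<le> cmod (k (r1 n) z)"
        using abs_Im_le_cmod[of "k (r1 n) z"] by linarith
      also have "\<dots> \<le> C * A (r1 n)" using that by (intro C) (simp add: S_def)
      also have "\<dots> \<le> C * M" using r1(2) C0 by (intro mult_left_mono)
      finally have "2 * pi * (- Im (k (r1 n) z)) \<le> 2 * pi * (C * M)"
        by (rule mult_left_mono) (rule less_imp_le, rule mult_pos_pos, rule zero_less_numeral, rule pi_gt_zero)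
      moreover have "z \<in> ball 0 1" using that S(4) by blast
      ultimately show ?thesis
        by (simp only: G_def norm_g exp_le_cancel_iff)
    qed
    obtain h s where "strict_mono s" and
      lim: "\<And>K. \<lbrakk>compact K; K \<subseteq> S\<rbrakk> \<Longrightarrow> uniform_limit K (G \<circ> s) h sequentially"
    proof (rule Montel[of S "range G" G])
      show "h holomorphic_on S" if "h \<in> range G" for h
        using that hol S(4) by (auto simp: G_def intro: holomorphic_on_subset)
      show "\<exists>B. \<forall>h\<in>range G. \<forall>z\<in>K. cmod (h z) \<le> B" if "K \<subseteq> S" for K
        using bound that by (intro exI[of _ "exp (2 * pi * (C * M))"]) blast
    qed (use S in auto)
    have "uniform_limit (ball 0 (1/16)) (G \<circ> s) h sequentially"
      by (rule uniform_limit_on_subset[OF lim[OF compact_cball S(6)]]) simp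
    then have "sphere_convergent_on (ball 0 (1/16)) (\<lambda>n. g ((r0 \<circ> r1 \<circ> s) n))"
      by (simp add: sphere_convergent_on_def G_def o_def) blast
    then show ?thesis
      using that[of "r0 \<circ> r1 \<circ> s"] r0(1) r1(1) \<open>strict_mono s\<close> by (simp add: strict_mono_o)
  next
    case False
    have Atop: "filterlim A at_top sequentially"
      unfolding filterlim_at_top
    proof
      fix M
      have "finite {n. \<not> M \<le> A n}"
        using False by (rule_tac finite_subset[of _ "{n. A n \<le> M}"]) auto
      then show "\<forall>\<^sub>F n in sequentially. M \<le> A n"
        by (simp add: eventually_cofinite flip: cofinite_eq_sequentially)
    qed
    define q where "q = (\<lambda>n z. k n z / of_real (A n))"
    obtain K r1 where K: "K holomorphic_on S" and r1: "strict_mono (r1 :: nat \<Rightarrow> nat)" and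
      pw: "\<And>x. x \<in> S \<Longrightarrow> (\<lambda>n. q (r1 n) x) \<longlonglongrightarrow> K x" and
      lim: "\<And>X. \<lbrakk>compact X; X \<subseteq> S\<rbrakk> \<Longrightarrow> uniform_limit X (q \<circ> r1) K sequentially"
    proof (rule Montel[of S "range q" q])
      show "h holomorphic_on S" if hq: "h \<in> range q" for h
      proof -
        obtain n where h: "h = q n" using hq by blast
        show ?thesis
          unfolding h q_def using A1[of n] holomorphic_on_subset[OF k(1) S(4)]
          by (intro holomorphic_intros) auto
      qed
      show "\<exists>B. \<forall>h\<in>range q. \<forall>z\<in>X. cmod (h z) \<le> B" if X: "X \<subseteq> S" for X
      proof (intro exI ballI)
        fix h z assume "h \<in> range q" "z \<in> X"
        then obtain n where h: "h = q n" by blast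
        have "cmod (k n z) \<le> C * A n"
          using \<open>z \<in> X\<close> X by (intro C) (auto simp: S_def)
        then show "cmod (h z) \<le> C"
          using A1[of n] by (simp add: h q_def norm_divide divide_simps)
      qed
    qed (use S in auto)
    \<comment> \<open>The zeros \<open>x n\<close> stay in a compact part of \<open>S\<close>; a
      limit point \<open>x0\<close> becomes a zero of \<open>K\<close>, which rules out nonzero
      constants.\<close>
    have "seq_compact (cball (0::complex) (1/8))"
      by (simp add: compact_imp_seq_compact)
    moreover have "\<forall>n. x (r1 n) \<in> cball 0 (1/8)"
      using x(1) by (simp add: less_imp_le)
    ultimately obtain x0 r2 where x0: "x0 \<in> cball 0 (1/8)" and r2: "strict_mono (r2 :: nat \<Rightarrow> nat)"
      and xlim: "(\<lambda>n. x (r1 (r2 n))) \<longlonglongrightarrow> x0"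
      by (elim seq_compactE[where f = "\<lambda>n. x (r1 n)"]) (auto simp: o_def)
    define r where "r = r1 \<circ> r2"
    have r: "strict_mono r" using r1 r2 by (simp add: r_def strict_mono_o)
    have lim': "uniform_limit X (\<lambda>n z. k (r n) z / of_real (A (r n))) K sequentially"
      if "compact X" "X \<subseteq> S" for X
    proof -
      have "uniform_limit X (\<lambda>n. (q \<circ> r1) (r2 n)) K sequentially"
        using filterlim_compose[OF lim[OF that] filterlim_subseq[OF r2]] by simp
      then show ?thesis by (simp add: q_def r_def)
    qed
    have Ar: "filterlim (\<lambda>n. A (r n)) at_top sequentially"
      using filterlim_compose[OF Atop filterlim_subseq[OF r]] .
    have pw': "(\<lambda>n. k (r n) z / of_real (A (r n))) \<longlonglongrightarrow> K z" if "z \<in> S" for z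
      using LIMSEQ_subseq_LIMSEQ[OF pw[OF that] r2] by (simp add: q_def r_def o_def)
    have contK: "continuous_on S K"
      using K by (rule holomorphic_on_imp_continuous_on)
    have Kx0: "K x0 = 0"
    proof -
      have "cmod (x n) < 3/16" for n using x(1)[of n] by simp
      then have "(\<lambda>n. K (x (r1 (r2 n)))) \<longlonglongrightarrow> K x0"
        using x0 S(5) by (intro continuous_on_tendsto_compose[OF contK xlim]) (auto simp: S_def)
      then have "(\<lambda>n. K (x (r n))) \<longlonglongrightarrow> K x0"
        by (simp add: r_def)
      moreover have "(\<lambda>n. K (x (r n))) \<longlonglongrightarrow> 0"
      proof (rule tendstoI)
        fix e :: real assume "e > 0"
        then have "\<forall>\<^sub>F n in sequentially. \<forall>z\<in>cball 0 (1/8). dist (k (r n) z / of_real (A (r n))) (K z) < e"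
          by (rule uniform_limitD[OF lim'[OF compact_cball S(5)]])
        then show "\<forall>\<^sub>F n in sequentially. dist (K (x (r n))) 0 < e"
        proof eventually_elim
          case (elim n)
          have "x (r n) \<in> cball 0 (1/8)" using x(1)[of "r n"] by simp
          then show ?case using elim k(2)[of "r n"] by (force simp: dist_commute)
        qed
      qed
      ultimately show ?thesis by (rule LIMSEQ_unique)
    qed
    \<comment> \<open>Only the constant 0 is left by the zero at \<open>x0\<close>. It is excluded
      because the three terms of \<open>A\<close>, divided by \<open>A\<close>, add up to 1 while
      \<open>1 / A\<close> tends to 0.\<close>
    have Knc: "\<not> K constant_on S"
    proof
      assume "K constant_on S"
      then have K0: "K z = 0" if "z \<in> S" for z
        using that Kx0 x0 S(5) by (auto simp: constant_on_def)
      have in_S: "\<i> / 8 \<in> S" "- \<i> / 8 \<in> S" by (auto simp: S_def norm_divide)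
      have "(\<lambda>n. 1 / A (r n) + cmod (k (r n) (\<i> / 8) / of_real (A (r n))) + cmod (k (r n) (- \<i> / 8) / of_real (A (r n))))
        \<longlonglongrightarrow> 0 + cmod (K (\<i> / 8)) + cmod (K (- \<i> / 8))"
        using Ar pw' in_S
        by (intro tendsto_intros tendsto_divide_0[OF tendsto_const] filterlim_at_top_imp_at_infinity)
      moreover have "1 / A (r n) + cmod (k (r n) (\<i> / 8) / of_real (A (r n))) + cmod (k (r n) (- \<i> / 8) / of_real (A (r n))) = 1" for n
      proof -
        have "cmod (v / of_real (A (r n))) = cmod v / A (r n)" for v
          using A1[of "r n"] by (simp add: norm_divide)
        then have "1 / A (r n) + cmod (k (r n) (\<i> / 8) / of_real (A (r n))) + cmod (k (r n) (- \<i> / 8) / of_real (A (r n)))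
            = (1 + cmod (k (r n) (\<i> / 8)) + cmod (k (r n) (- \<i> / 8))) / A (r n)"
          by (simp only: add_divide_distrib)
        also have "\<dots> = A (r n) / A (r n)" by (simp only: A_def)
        also have "\<dots> = 1" using A1[of "r n"] by simp
        finally show ?thesis .
      qed
      ultimately show False
        using K0 in_S by (simp add: LIMSEQ_const_iff)
    qed
    have K_real: "Im z = 0" if "z \<in> S" "Im (K z) = 0" for z
    proof (rule rescaled_limit_real_preimages[of S "\<lambda>n. k (r n)" K "\<lambda>n. A (r n)"])
      show "k (r n) holomorphic_on S" for n
        using k(1) S(4) by (rule holomorphic_on_subset)
      show "Im u = 0" if "u \<in> S" "k (r n) u \<in> \<int>" for n u
        using k_real S(4) that by blast
      show "A (r n) > 0" for n using A1[of "r n"] by simp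
    qed (use S K Knc Ar lim' that in auto)
    have ImK: "continuous_on S (\<lambda>z. Im (K z))"
      using contK by (intro continuous_intros)
    \<comment> \<open>By the open mapping theorem \<open>K\<close> covers a disk about its value 0
      at \<open>x0\<close>, so both signs of \<open>Im K\<close> occur. They occur on open sets, and
      these contain points off the line.\<close>
    have attained: "\<exists>z\<in>S. Im z \<noteq> 0 \<and> s * Im (K z) > 0" if s: "s \<noteq> 0" for s
    proof -
      have "open (K ` S)"
        using open_mapping_thm[OF K S(1) S(3) S(1) order_refl Knc] .
      moreover have "0 \<in> K ` S" using Kx0 x0 S(5) by (metis imageI subsetD)
      ultimately obtain e where e: "e > 0" "cball 0 e \<subseteq> K ` S"
        using open_contains_cball by blast
      have "of_real (e * sgn s) * \<i> \<in> K ` S"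
        using e s by (intro subsetD[OF e(2)]) (simp add: norm_mult abs_mult)
      then obtain z where z: "z \<in> S" "K z = of_real (e * sgn s) * \<i>" by force
      have "open {z \<in> S. s * Im (K z) > 0}"
        using continuous_open_preimage[OF continuous_on_mult_left[OF ImK, of s] S(1) open_greaterThan[of 0]]
        by (simp add: vimage_def Int_def)
      moreover have "z \<in> {z \<in> S. s * Im (K z) > 0}"
        using z e(1) s by (auto simp: sgn_if mult_less_0_iff)
      ultimately show ?thesis
        using open_imp_nonreal by blast
    qed
    define T where "T = (\<lambda>s::real. {z \<in> S. s * Im z > 0})"
    have convT: "connected (T s)" for s
    proof -
      have "T s = S \<inter> {u. (\<i> * of_real s) \<bullet> u > 0}"
        by (auto simp: T_def inner_complex_def)
      then show ?thesis
        using S(2) by (auto intro!: convex_connected convex_Int convex_halfspace_gt)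
    qed
    \<comment> \<open>\<open>Im K\<close> has no zeros off the line and hence a constant sign in
      each half of \<open>S\<close>.\<close>
    have sign: "s' * Im (K b) > 0" if "a \<in> T s" "b \<in> T s" "s' * Im (K a) > 0" for a b s s'
    proof (rule connected_constant_sign[where T = "T s" and \<phi> = "\<lambda>z. s' * Im (K z)" and a = a])
      show "continuous_on (T s) (\<lambda>z. s' * Im (K z))"
        by (intro continuous_on_mult_left continuous_on_subset[OF ImK]) (auto simp: T_def)
      show "s' * Im (K z) \<noteq> 0" if "z \<in> T s" for z
        using K_real[of z] that \<open>s' * Im (K a) > 0\<close> by (auto simp: T_def)
    qed (use that convT in auto)
    have to_zero: "(\<lambda>n. g (r0 (r n)) z) \<longlonglongrightarrow> 0" if "z \<in> S" "Im (K z) > 0" for z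
    proof -
      have "(\<lambda>n. Im (k (r n) z / of_real (A (r n)))) \<longlonglongrightarrow> Im (K z)"
        using pw'[OF that(1)] by (rule tendsto_Im)
      then have "filterlim (\<lambda>n. Im (k (r n) z / of_real (A (r n))) * A (r n)) at_top sequentially"
        using that(2) Ar by (rule filterlim_tendsto_pos_mult_at_top)
      moreover have "Im (k (r n) z / of_real (A (r n))) * A (r n) = Im (k (r n) z)" for n
        using A1[of "r n"] by simp
      ultimately have "filterlim (\<lambda>n. Im (k (r n) z)) at_top sequentially" by simp
      then have "filterlim (\<lambda>n. 2 * pi * (- Im (k (r n) z))) at_bot sequentially"
        using filterlim_tendsto_neg_mult_at_bot[OF tendsto_const, of "- (2 * pi)"] by simp
      then have "(\<lambda>n. exp (2 * pi * (- Im (k (r n) z)))) \<longlonglongrightarrow> 0"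
        by (rule filterlim_compose[OF exp_at_bot])
      moreover have "z \<in> ball 0 1" using that(1) S(4) by blast
      ultimately show ?thesis
        by - (rule tendsto_norm_zero_cancel, simp only: norm_g)
    qed
    have to_infinity: "filterlim (\<lambda>n. g (r0 (r n)) z) at_infinity sequentially"
      if "z \<in> S" "Im (K z) < 0" for z
    proof -
      have "(\<lambda>n. - Im (k (r n) z / of_real (A (r n)))) \<longlonglongrightarrow> - Im (K z)"
        using pw'[OF that(1)] by (intro tendsto_intros)
      then have "filterlim (\<lambda>n. - Im (k (r n) z / of_real (A (r n))) * A (r n)) at_top sequentially"
        by (rule filterlim_tendsto_pos_mult_at_top) (use that(2) Ar in auto)
      moreover have "- Im (k (r n) z / of_real (A (r n))) * A (r n) = - Im (k (r n) z)" for n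
        using A1[of "r n"] by simp
      ultimately have "filterlim (\<lambda>n. - Im (k (r n) z)) at_top sequentially" by simp
      then have "filterlim (\<lambda>n. (2 * pi) * (- Im (k (r n) z))) at_top sequentially"
        by (intro filterlim_tendsto_pos_mult_at_top[OF tendsto_const]) auto
      then have "filterlim (\<lambda>n. exp ((2 * pi) * (- Im (k (r n) z)))) at_top sequentially"
        by (rule filterlim_compose[OF exp_at_top])
      moreover have "z \<in> ball 0 1" using that(1) S(4) by blast
      ultimately show ?thesis
        by - (rule filterlim_norm_at_top_imp_at_infinity, simp only: norm_g)
    qed
    obtain a where a: "a \<in> S" "Im a \<noteq> 0" "Im (K a) > 0"
      using attained[of 1] by auto
    obtain b where b: "b \<in> S" "Im b \<noteq> 0" "Im (K b) < 0"
      using attained[of "-1"] by auto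
    \<comment> \<open>Each half carries a single sign, so the witnesses \<open>a\<close> and
      \<open>b\<close> of the two signs lie in different halves.\<close>
    have same: "\<not> (a \<in> T s \<and> b \<in> T s)" for s
      using sign[of a s b 1] a b by auto
    have half: "zero_infinity_limits {z \<in> ball 0 (1/16). s * Im z > 0} {z \<in> ball 0 (1/16). - s * Im z > 0} (\<lambda>n. g (r0 (r n)))"
      if "a \<in> T s" "b \<in> T (- s)" for s
      unfolding zero_infinity_limits_def
    proof (intro conjI ballI)
      fix z assume "z \<in> {z \<in> ball 0 (1/16). s * Im z > 0}"
      then show "(\<lambda>n. g (r0 (r n)) z) \<longlonglongrightarrow> 0"
        using sign[OF that(1), of z 1] a(3) S(7) by (intro to_zero) (auto simp: T_def)
    next
      fix z assume "z \<in> {z \<in> ball 0 (1/16). - s * Im z > 0}"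
      then show "filterlim (\<lambda>n. g (r0 (r n)) z) at_infinity sequentially"
        using sign[OF that(2), of z "-1"] b(3) S(7) by (intro to_infinity) (auto simp: T_def)
    qed
    have "(a \<in> T 1 \<and> b \<in> T (-1)) \<or> (a \<in> T (-1) \<and> b \<in> T 1)"
      using a b same[of 1] same[of "-1"] by (auto simp: T_def)
    then show ?thesis
      using half[of 1] half[of "-1"] that[of "r0 \<circ> r"] r0(1) r by (auto simp: strict_mono_o)
  qed
qed

section \<open>Spherical convergence\<close>

text \<open>For unit vectors, 1 minus the inner product is half the squared chord. Here it equals
  \<open>2 * (cmod (z - w))\<^sup>2 / (P * Q)\<close> exactly, and \<open>P * Q \<ge> 1\<close>
  gives the bound.\<close>

lemma inner_stereo_Finite:
  "stereo (Finite z) \<bullet> stereo (Finite w) \<ge> 1 - 2 * (cmod (z - w))\<^sup>2"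
proof -
  define P Q where "P = 1 + (cmod z)\<^sup>2" and "Q = 1 + (cmod w)\<^sup>2"
  have PQ: "P \<ge> 1" "Q \<ge> 1" by (simp_all add: P_def Q_def)
  have zw: "(cmod (z - w))\<^sup>2 = (cmod z)\<^sup>2 + (cmod w)\<^sup>2 - 2 * (z \<bullet> w)"
    by (simp add: power2_norm_eq_inner inner_diff_left inner_diff_right inner_commute)
  have s: "stereo (Finite u) = ((2 / (1 + (cmod u)\<^sup>2)) *\<^sub>R u, ((cmod u)\<^sup>2 - 1) / (1 + (cmod u)\<^sup>2))" for u
    by (simp add: scaleR_conv_of_real add.commute)
  have "stereo (Finite z) \<bullet> stereo (Finite w) = (4 * (z \<bullet> w) + ((cmod z)\<^sup>2 - 1) * ((cmod w)\<^sup>2 - 1)) / (P * Q)"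
    unfolding s inner_prod_def fst_conv snd_conv inner_scaleR_left inner_scaleR_right P_def Q_def
    by (simp add: add_divide_distrib)
  also have "4 * (z \<bullet> w) + ((cmod z)\<^sup>2 - 1) * ((cmod w)\<^sup>2 - 1) = P * Q - 2 * (cmod (z - w))\<^sup>2"
    unfolding zw P_def Q_def by (simp add: algebra_simps)
  also have "(P * Q - 2 * (cmod (z - w))\<^sup>2) / (P * Q) = 1 - 2 * (cmod (z - w))\<^sup>2 / (P * Q)"
    using PQ by (simp add: diff_divide_distrib)
  finally have "stereo (Finite z) \<bullet> stereo (Finite w) = 1 - 2 * (cmod (z - w))\<^sup>2 / (P * Q)" .
  moreover have "2 * (cmod (z - w))\<^sup>2 / (P * Q) \<le> 2 * (cmod (z - w))\<^sup>2 / 1"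
    using PQ mult_mono[of 1 P 1 Q] by (intro divide_left_mono) auto
  ultimately show ?thesis by simp
qed

lemma inner_stereo_Infty:
  "stereo (Finite z) \<bullet> stereo Infty = 1 - 2 / (1 + (cmod z)\<^sup>2)"
proof -
  have "1 + (cmod z)\<^sup>2 > 0" by (simp add: add_pos_nonneg)
  then show ?thesis by (simp add: inner_prod_def field_simps)
qed

lemma dist_sphere_less:
  assumes "0 < e"
  obtains d where "0 < d" "\<And>p q. 1 - d < stereo p \<bullet> stereo q \<Longrightarrow> dist p q < e"
proof
  \<comment> \<open>Distance \<open>e'\<close> corresponds to the inner product
    \<open>cos e'\<close> as long as \<open>e' \<le> pi\<close>.\<close>
  define e' where "e' = min e pi"
  have e': "0 < e'" "e' \<le> pi" "e' \<le> e"
    using assms by (auto simp: e'_def)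
  show "0 < 1 - cos e'"
    using cos_monotone_0_pi[of 0 e'] e' by simp
  fix p q :: riemann_sphere
  assume "1 - (1 - cos e') < stereo p \<bullet> stereo q"
  moreover have "\<bar>stereo p \<bullet> stereo q\<bar> \<le> 1"
    using Cauchy_Schwarz_ineq2[of "stereo p" "stereo q"] by simp
  ultimately have "arccos (stereo p \<bullet> stereo q) < arccos (cos e')"
    by (intro arccos_less_arccos) auto
  then show "dist p q < e"
    using e' by (simp add: dist_riemann_sphere_def arccos_cos)
qed

lemma sphere_convergent_imp_uniform_limit:
  assumes "sphere_convergent_on V f"
  shows "\<exists>g. uniform_limit V (\<lambda>n z. Finite (f n z)) g sequentially"
  using assms unfolding sphere_convergent_on_def
proof
  assume "\<exists>h. uniform_limit V f h sequentially"
  then obtain h where h: "uniform_limit V f h sequentially" by blast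
  have "uniform_limit V (\<lambda>n z. Finite (f n z)) (\<lambda>z. Finite (h z)) sequentially"
  proof (rule uniform_limitI)
    fix e :: real assume "e > 0"
    then obtain d where d: "0 < d" "\<And>p q. 1 - d < stereo p \<bullet> stereo q \<Longrightarrow> dist p q < e"
      by (rule dist_sphere_less) blast
    \<comment> \<open>\<open>sqrt (d / 2)\<close> is the modulus at which the loss
      \<open>2 * (cmod (z - w))\<^sup>2\<close> in the inner product equals
      \<open>d\<close>.\<close>
    have "\<forall>\<^sub>F n in sequentially. \<forall>z\<in>V. dist (f n z) (h z) < sqrt (d / 2)"
      using d by (intro uniform_limitD[OF h]) auto
    then show "\<forall>\<^sub>F n in sequentially. \<forall>z\<in>V. dist (Finite (f n z)) (Finite (h z)) < e"
    proof eventually_elim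
      case (elim n)
      show ?case
      proof
        fix z assume "z \<in> V"
        then have "cmod (f n z - h z) < sqrt (d / 2)" using elim by (simp add: dist_norm)
        then have "(cmod (f n z - h z))\<^sup>2 < (sqrt (d / 2))\<^sup>2"
          by (intro power_strict_mono) auto
        then have "1 - d < 1 - 2 * (cmod (f n z - h z))\<^sup>2" using d(1) by simp
        then show "dist (Finite (f n z)) (Finite (h z)) < e"
          using inner_stereo_Finite[of "f n z" "h z"] by (intro d(2)) linarith
      qed
    qed
  qed
  then show ?thesis by blast
next
  assume inf: "\<forall>M. \<forall>\<^sub>F n in sequentially. \<forall>z\<in>V. M \<le> cmod (f n z)"
  have "uniform_limit V (\<lambda>n z. Finite (f n z)) (\<lambda>_. Infty) sequentially"
  proof (rule uniform_limitI)
    fix e :: real assume "e > 0"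
    then obtain d where d: "0 < d" "\<And>p q. 1 - d < stereo p \<bullet> stereo q \<Longrightarrow> dist p q < e"
      by (rule dist_sphere_less) blast
    \<comment> \<open>It suffices that \<open>1 + (cmod (f n z))\<^sup>2\<close> exceeds
      \<open>2 / d\<close>; the extra 1 makes the modulus at least 1, so that its square dominates
      it.\<close>
    have "\<forall>\<^sub>F n in sequentially. \<forall>z\<in>V. 2 / d + 1 \<le> cmod (f n z)"
      using inf by blast
    then show "\<forall>\<^sub>F n in sequentially. \<forall>z\<in>V. dist (Finite (f n z)) Infty < e"
    proof eventually_elim
      case (elim n)
      show ?case
      proof
        fix z assume "z \<in> V"
        then have c: "2 / d + 1 \<le> cmod (f n z)" using elim by blast
        moreover have "2 / d > 0" using d(1) by simp
        ultimately have "cmod (f n z) * 1 \<le> cmod (f n z) * cmod (f n z)"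
          by (intro mult_left_mono) linarith+
        then have "2 / d < 1 + (cmod (f n z))\<^sup>2"
          using c unfolding power2_eq_square by linarith
        then have "2 / (1 + (cmod (f n z))\<^sup>2) < d"
          using d(1) by (simp add: divide_less_eq add_pos_nonneg mult.commute)
        then show "dist (Finite (f n z)) Infty < e"
          by (intro d(2)) (simp add: inner_stereo_Infty del: stereo.simps)
      qed
    qed
  qed
  then show ?thesis by blast
qed

text \<open>\<open>\<phi>\<close> need not be injective, as exp on a large disk: the limit is formed
  with an arbitrary choice of preimages, which is harmless because \<open>f n w\<close> depends on
  \<open>w\<close> only.\<close>

lemma sphere_convergent_on_image:
  assumes "sphere_convergent_on V (\<lambda>n z. f n (\<phi> z))"
  shows "sphere_convergent_on (\<phi> ` V) f"
  using assms unfolding sphere_convergent_on_def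
proof (elim disj_forward)
  assume "\<exists>h. uniform_limit V (\<lambda>n z. f n (\<phi> z)) h sequentially"
  then obtain h where h: "uniform_limit V (\<lambda>n z. f n (\<phi> z)) h sequentially" by blast
  have "uniform_limit (\<phi> ` V) f (\<lambda>w. h (inv_into V \<phi> w)) sequentially"
  proof (rule uniform_limitI)
    fix e :: real assume "e > 0"
    with h have "\<forall>\<^sub>F n in sequentially. \<forall>z\<in>V. dist (f n (\<phi> z)) (h z) < e"
      by (rule uniform_limitD)
    then show "\<forall>\<^sub>F n in sequentially. \<forall>w\<in>\<phi> ` V. dist (f n w) (h (inv_into V \<phi> w)) < e"
      by eventually_elim (metis f_inv_into_f inv_into_into)
  qed
  then show "\<exists>h. uniform_limit (\<phi> ` V) f h sequentially" by blast
qed auto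

lemma sphere_convergent_on_one_minus:
  assumes "sphere_convergent_on V (\<lambda>n z. 1 - f n z)"
  shows "sphere_convergent_on V f"
  using assms unfolding sphere_convergent_on_def
proof (elim disj_forward)
  assume "\<exists>h. uniform_limit V (\<lambda>n z. 1 - f n z) h sequentially"
  then obtain h where "uniform_limit V (\<lambda>n z. 1 - f n z) h sequentially" by blast
  then have "uniform_limit V (\<lambda>n z. 1 - (1 - f n z)) (\<lambda>z. 1 - h z) sequentially"
    by (rule uniform_limit_minus[OF uniform_limit_const])
  then show "\<exists>h. uniform_limit V f h sequentially" by auto
next
  assume inf: "\<forall>M. \<forall>\<^sub>F n in sequentially. \<forall>z\<in>V. M \<le> cmod (1 - f n z)"
  show "\<forall>M. \<forall>\<^sub>F n in sequentially. \<forall>z\<in>V. M \<le> cmod (f n z)"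
  proof
    fix M
    have "\<forall>\<^sub>F n in sequentially. \<forall>z\<in>V. M + 1 \<le> cmod (1 - f n z)" using inf by blast
    then show "\<forall>\<^sub>F n in sequentially. \<forall>z\<in>V. M \<le> cmod (f n z)"
    proof eventually_elim
      case (elim n)
      show ?case
      proof
        fix z assume "z \<in> V"
        then show "M \<le> cmod (f n z)"
          using elim norm_triangle_ineq4[of 1 "f n z"] by fastforce
      qed
    qed
  qed
qed

lemma not_sphere_convergent_on:
  assumes "p \<in> V" "(\<lambda>n. f n p) \<longlonglongrightarrow> c" "q \<in> V" "filterlim (\<lambda>n. f n q) at_infinity sequentially"
  shows "\<not> sphere_convergent_on V f"
  unfolding sphere_convergent_on_def
proof (intro notI, elim disjE exE)
  fix h assume "uniform_limit V f h sequentially"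
  then have "(\<lambda>n. f n q) \<longlonglongrightarrow> h q"
    using assms(3) by (rule tendsto_uniform_limitI)
  then show False
    using assms(4) by (rule not_tendsto_and_filterlim_at_infinity[OF trivial_limit_sequentially])
next
  assume inf: "\<forall>M. \<forall>\<^sub>F n in sequentially. \<forall>z\<in>V. M \<le> cmod (f n z)"
  have "filterlim (\<lambda>n. cmod (f n p)) at_top sequentially"
    unfolding filterlim_at_top
  proof
    fix M
    have "\<forall>\<^sub>F n in sequentially. \<forall>z\<in>V. M \<le> cmod (f n z)" using inf by blast
    then show "\<forall>\<^sub>F n in sequentially. M \<le> cmod (f n p)"
      by eventually_elim (use assms(1) in blast)
  qed
  then have "filterlim (\<lambda>n. f n p) at_infinity sequentially"
    by (rule filterlim_norm_at_top_imp_at_infinity)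
  then show False
    by (rule not_tendsto_and_filterlim_at_infinity[OF trivial_limit_sequentially assms(2)])
qed

text \<open>Countably many of the good neighbourhoods cover \<open>U\<close> by Lindelof's theorem,
  and a diagonal subsequence converges on all of them. The neighbourhood has to be chosen before the
  sequence, so that it survives the passage to subsequences.\<close>

lemma normal_family_on_local:
  assumes loc: "\<And>z. z \<in> U \<Longrightarrow> \<exists>V. open V \<and> z \<in> V \<and>
      (\<forall>f :: nat \<Rightarrow> complex \<Rightarrow> complex. (\<forall>n. f n \<in> \<F>) \<longrightarrow>
        (\<exists>r :: nat \<Rightarrow> nat. strict_mono r \<and> sphere_convergent_on V (\<lambda>n. f (r n))))"
  shows "normal_family_on U \<F>"
  unfolding normal_family_on_def
proof (intro allI impI)
  fix f :: "nat \<Rightarrow> complex \<Rightarrow> complex"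
  assume f: "\<forall>n. f n \<in> \<F>"
  define good where "good = (\<lambda>V. open V \<and> (\<forall>f :: nat \<Rightarrow> complex \<Rightarrow> complex. (\<forall>n. f n \<in> \<F>) \<longrightarrow>
        (\<exists>r :: nat \<Rightarrow> nat. strict_mono r \<and> sphere_convergent_on V (\<lambda>n. f (r n)))))"
  \<comment> \<open>The empty set is adjoined to the cover because \<open>from_nat_into\<close>
    enumerates a nonempty set only.\<close>
  have "good {}"
    by (auto simp: good_def sphere_convergent_on_def intro!: exI[of _ id] strict_mono_id)
  obtain \<C> where \<C>: "\<C> \<subseteq> Collect good" "countable \<C>" "\<Union>\<C> = \<Union>(Collect good)"
    using Lindelof[of "Collect good"] by (auto simp: good_def)
  define V where "V = from_nat_into (insert {} \<C>)"
  have V_good: "good (V n)" for n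
    using from_nat_into[of "insert {} \<C>" n] \<C>(1) \<open>good {}\<close> by (auto simp: V_def)
  have cover: "\<exists>n. z \<in> V n" if z: "z \<in> U" for z
  proof -
    have "\<exists>W. good W \<and> z \<in> W"
      using loc[OF z] unfolding good_def by blast
    then have "z \<in> \<Union>(Collect good)" by blast
    then obtain W where "W \<in> \<C>" "z \<in> W"
      using \<C>(3) by blast
    moreover obtain n where "V n = W"
      using from_nat_into_surj[of "insert {} \<C>" W] \<C>(2) \<open>W \<in> \<C>\<close> by (auto simp: V_def)
    ultimately show ?thesis by blast
  qed
  define P where "P = (\<lambda>n s. \<exists>g. uniform_limit (V n) (\<lambda>k z. Finite (f (s k) z)) g sequentially)"
  have P_dest: "\<exists>g. uniform_limit (V n) (\<lambda>k z. Finite (f (s k) z)) g sequentially" if "P n s" for n s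
    using that by (simp add: P_def)
  interpret subseqs P
  proof
    fix n and s :: "nat \<Rightarrow> nat"
    assume "strict_mono s"
    have "\<exists>r :: nat \<Rightarrow> nat. strict_mono r \<and> sphere_convergent_on (V n) (\<lambda>k. F (r k))"
      if "\<And>k. F k \<in> \<F>" for F
      using V_good[of n] that unfolding good_def by blast
    from this[of "\<lambda>k. f (s k)"] obtain r where r: "strict_mono (r :: nat \<Rightarrow> nat)" "sphere_convergent_on (V n) (\<lambda>k. f (s (r k)))"
      using f by blast
    then show "\<exists>r'. strict_mono r' \<and> P n (s \<circ> r')"
      using sphere_convergent_imp_uniform_limit[OF r(2)] by (auto simp: P_def)
  qed
  \<comment> \<open>Only the tail of the diagonal sequence from \<open>Suc n\<close> on is a
    subsequence of the one chosen for \<open>V n\<close>; the shift is removed again below.\<close>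
  have diag: "P n (diagseq \<circ> (+) (Suc n))" for n
  proof (rule diagseq_holds)
    fix r s :: "nat \<Rightarrow> nat" and n
    assume r: "strict_mono r" and "P n s"
    then obtain g where "uniform_limit (V n) (\<lambda>k z. Finite (f (s k) z)) g sequentially"
      by (auto simp: P_def)
    then have "uniform_limit (V n) (\<lambda>k z. Finite (f (s (r k)) z)) g sequentially"
      using filterlim_subseq[OF r] by (rule filterlim_compose)
    then show "P n (s \<circ> r)"
      by (auto simp: P_def)
  qed
  have "\<forall>n. \<exists>g. uniform_limit (V n) (\<lambda>k z. Finite (f (diagseq (Suc n + k)) z)) g sequentially"
    using P_dest[OF diag] by (simp only: o_def) blast
  from choice[OF this] obtain G where
    G: "\<And>n. uniform_limit (V n) (\<lambda>k z. Finite (f (diagseq (Suc n + k)) z)) (G n) sequentially"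
    by blast
  have G: "uniform_limit (V n) (\<lambda>k z. Finite (f (diagseq k) z)) (G n) sequentially" for n
  proof (rule uniform_limitI)
    fix e :: real assume "e > 0"
    with G[of n] have "\<forall>\<^sub>F k in sequentially. \<forall>z\<in>V n. dist (Finite (f (diagseq (Suc n + k)) z)) (G n z) < e"
      by (rule uniform_limitD)
    then show "\<forall>\<^sub>F k in sequentially. \<forall>z\<in>V n. dist (Finite (f (diagseq k) z)) (G n z) < e"
      using eventually_sequentially_seg[of "\<lambda>k. \<forall>z\<in>V n. dist (Finite (f (diagseq k) z)) (G n z) < e" "Suc n"]
      by (simp add: add.commute)
  qed
  \<comment> \<open>Pointwise limits glue the functions \<open>G n\<close>: on overlaps they agree
    by uniqueness of limits.\<close>
  define g where "g = (\<lambda>z. lim (\<lambda>k. Finite (f (diagseq k) z)))"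
  have g: "g z = G n z" if "z \<in> V n" for z n
    unfolding g_def using tendsto_uniform_limitI[OF G that] by (rule limI)
  have "locally_uniform_limit U (\<lambda>k z. Finite (f (diagseq k) z)) g"
    unfolding locally_uniform_limit_def
  proof
    fix z assume "z \<in> U"
    then obtain n where n: "z \<in> V n" using cover by blast
    have "uniform_limit (V n) (\<lambda>k z. Finite (f (diagseq k) z)) g sequentially"
      using G[of n] g by (simp cong: uniform_limit_cong')
    then have "uniform_limit (U \<inter> V n) (\<lambda>k z. Finite (f (diagseq k) z)) g sequentially"
      by (rule uniform_limit_on_subset) auto
    then show "\<exists>W. open W \<and> z \<in> W \<and> uniform_limit (U \<inter> W) (\<lambda>k z. Finite (f (diagseq k) z)) g sequentially"
      using V_good[of n] n by (auto simp: good_def)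
  qed
  then show "\<exists>r g. strict_mono (r :: nat \<Rightarrow> nat) \<and> locally_uniform_limit U (\<lambda>n z. Finite (f (r n) z)) g"
    using subseq_diagseq by blast
qed

section \<open>Values on horizontal lines\<close>

lemma zero_infinity_limits_image:
  "zero_infinity_limits S T (\<lambda>n u. g n (\<phi> u)) \<Longrightarrow> zero_infinity_limits (\<phi> ` S) (\<phi> ` T) g"
  by (auto simp: zero_infinity_limits_def)

lemma dichotomy_on_ball:
  fixes g :: "nat \<Rightarrow> complex \<Rightarrow> complex"
  assumes R: "R > 0"
    and hol: "\<And>n. g n holomorphic_on ball z0 R"
    and nz: "\<And>n z. z \<in> ball z0 R \<Longrightarrow> g n z \<noteq> 0"
    and one: "\<And>n z. \<lbrakk>z \<in> ball z0 R; g n z = 1\<rbrakk> \<Longrightarrow> Im z = Im z0"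
  obtains r :: "nat \<Rightarrow> nat" where "strict_mono r"
    "sphere_convergent_on (ball z0 (R/16)) (\<lambda>n. g (r n)) \<or>
     zero_infinity_limits {z \<in> ball z0 (R/16). Im z > Im z0} {z \<in> ball z0 (R/16). Im z < Im z0} (\<lambda>n. g (r n)) \<or>
     zero_infinity_limits {z \<in> ball z0 (R/16). Im z < Im z0} {z \<in> ball z0 (R/16). Im z > Im z0} (\<lambda>n. g (r n))"
proof -
  define \<phi> where "\<phi> = (\<lambda>u. z0 + of_real R * u)"
  have \<phi>_ball: "\<phi> u \<in> ball z0 (R * t) \<longleftrightarrow> u \<in> ball 0 t" for u t
    using R by (simp add: \<phi>_def dist_norm norm_mult)
  have \<phi>_inv: "\<phi> ((z - z0) / of_real R) = z" for z
    using R by (simp add: \<phi>_def)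
  have Im_inv: "Im ((z - z0) / of_real R) = (Im z - Im z0) / R" for z
    by (simp add: Im_divide_of_real)
  have img: "\<phi> ` {u \<in> ball 0 (1/16). Q u} = {z \<in> ball z0 (R/16). Q ((z - z0) / of_real R)}" for Q
  proof (intro equalityI subsetI)
    fix z assume "z \<in> \<phi> ` {u \<in> ball 0 (1/16). Q u}"
    then obtain u where u: "z = \<phi> u" "u \<in> ball 0 (1/16)" "Q u" by blast
    then show "z \<in> {z \<in> ball z0 (R/16). Q ((z - z0) / of_real R)}"
      using \<phi>_ball[of u "1/16"] R by (simp add: \<phi>_def)
  next
    fix z assume "z \<in> {z \<in> ball z0 (R/16). Q ((z - z0) / of_real R)}"
    then have "(z - z0) / of_real R \<in> {u \<in> ball 0 (1/16). Q u}"
      using \<phi>_ball[of "(z - z0) / of_real R" "1/16"] by (simp add: \<phi>_inv)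
    then have "\<phi> ((z - z0) / of_real R) \<in> \<phi> ` {u \<in> ball 0 (1/16). Q u}" by (rule imageI)
    then show "z \<in> \<phi> ` {u \<in> ball 0 (1/16). Q u}"
      by (simp only: \<phi>_inv)
  qed
  have halves: "\<phi> ` {u \<in> ball 0 (1/16). Im u > 0} = {z \<in> ball z0 (R/16). Im z > Im z0}"
    "\<phi> ` {u \<in> ball 0 (1/16). Im u < 0} = {z \<in> ball z0 (R/16). Im z < Im z0}"
    unfolding img Im_inv using R by (auto simp: divide_less_0_iff zero_less_divide_iff)
  have \<phi>1: "\<phi> u \<in> ball z0 R" if "u \<in> ball 0 1" for u
    using \<phi>_ball[of u 1] that by simp
  obtain r :: "nat \<Rightarrow> nat" where r: "strict_mono r" and dich:
    "sphere_convergent_on (ball 0 (1/16)) (\<lambda>n u. g (r n) (\<phi> u)) \<or>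
     zero_infinity_limits {z \<in> ball 0 (1/16). Im z > 0} {z \<in> ball 0 (1/16). Im z < 0} (\<lambda>n u. g (r n) (\<phi> u)) \<or>
     zero_infinity_limits {z \<in> ball 0 (1/16). Im z < 0} {z \<in> ball 0 (1/16). Im z > 0} (\<lambda>n u. g (r n) (\<phi> u))"
  proof (rule dichotomy_unit_ball[of "\<lambda>n u. g n (\<phi> u)"])
    show "(\<lambda>u. g n (\<phi> u)) holomorphic_on ball 0 1" for n
      using \<phi>1 by (intro holomorphic_on_compose_gen[OF _ hol, unfolded o_def])
        (auto simp: \<phi>_def intro!: holomorphic_intros)
    show "g n (\<phi> u) \<noteq> 0" if "u \<in> ball 0 1" for n u
      using nz \<phi>1[OF that] .
    show "Im u = 0" if "u \<in> ball 0 1" "g n (\<phi> u) = 1" for n u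
      using one[OF \<phi>1[OF that(1)] that(2)] R by (simp add: \<phi>_def)
  qed blast
  have img_ball: "\<phi> ` ball 0 (1/16) = ball z0 (R/16)"
    using img[of "\<lambda>_. True"] by (simp add: ball_def)
  note transfer = zero_infinity_limits_image[where g = "\<lambda>n. g (r n)" and \<phi> = \<phi>]
  show ?thesis
    using dich sphere_convergent_on_image[of "ball 0 (1/16)" "\<lambda>n. g (r n)" \<phi>, unfolded img_ball]
      transfer[of "{u \<in> ball 0 (1/16). Im u > 0}" "{u \<in> ball 0 (1/16). Im u < 0}", unfolded halves]
      transfer[of "{u \<in> ball 0 (1/16). Im u < 0}" "{u \<in> ball 0 (1/16). Im u > 0}", unfolded halves]
      that[OF r] by argo
qed

text \<open>Convergence on \<open>W\<close> excludes escape to infinity, and the identity theorem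
  makes the limit supplied by Montel's theorem equal to \<open>c\<close> everywhere.
  \<open>c\<close> may be one of the omitted values; it is 1 in the application.\<close>

lemma propagate_finite_limit:
  fixes f :: "nat \<Rightarrow> complex \<Rightarrow> complex"
  assumes S: "open S" "connected S"
    and hol: "\<And>n. f n holomorphic_on S"
    and omit: "\<And>n z. z \<in> S \<Longrightarrow> f n z \<noteq> 0 \<and> f n z \<noteq> 1"
    and W: "open W" "W \<noteq> {}" "W \<subseteq> S" "\<And>z. z \<in> W \<Longrightarrow> (\<lambda>n. f n z) \<longlonglongrightarrow> c"
  obtains r :: "nat \<Rightarrow> nat" where "strict_mono r" "\<And>z. z \<in> S \<Longrightarrow> (\<lambda>n. f (r n) z) \<longlonglongrightarrow> c"
proof (rule Montel_omitting_01[OF S hol omit])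
  fix r :: "nat \<Rightarrow> nat" and h
  assume r: "strict_mono r" and h: "h holomorphic_on S"
    and lim: "\<And>K. \<lbrakk>compact K; K \<subseteq> S\<rbrakk> \<Longrightarrow> uniform_limit K (\<lambda>n. f (r n)) h sequentially"
  have pw: "(\<lambda>n. f (r n) z) \<longlonglongrightarrow> h z" if "z \<in> S" for z
    using lim[of "{z}"] that by (auto intro: tendsto_uniform_limitI)
  have "h z = c" if "z \<in> W" for z
    using LIMSEQ_unique[OF pw[of z] LIMSEQ_subseq_LIMSEQ[OF W(4)[OF that] r, unfolded o_def]] W(3) that
    by blast
  then have "h z = c" if "z \<in> S" for z
    using analytic_continuation_open[OF W(1) S(1) W(2) S(2) W(3) h holomorphic_on_const[of c] _ that] by blast
  then show thesis
    using that[OF r] pw by metis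
next
  fix r :: "nat \<Rightarrow> nat"
  assume r: "strict_mono r"
    and inf: "\<And>K M. \<lbrakk>compact K; K \<subseteq> S\<rbrakk> \<Longrightarrow> \<forall>\<^sub>F n in sequentially. \<forall>z\<in>K. M \<le> cmod (f (r n) z)"
  obtain w where w: "w \<in> W" using W(2) by blast
  have "filterlim (\<lambda>n. cmod (f (r n) w)) at_top sequentially"
    unfolding filterlim_at_top using inf[of "{w}"] w W(3) by auto
  then have "filterlim (\<lambda>n. f (r n) w) at_infinity sequentially"
    by (rule filterlim_norm_at_top_imp_at_infinity)
  then show thesis
    using not_tendsto_and_filterlim_at_infinity[OF trivial_limit_sequentially
        LIMSEQ_subseq_LIMSEQ[OF W(4)[OF w] r, unfolded o_def]] by blast
qed

text \<open>A single point \<open>w\<close> decides here, since a finite limit function would have a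
  finite value at \<open>w\<close>.\<close>

lemma propagate_infinite_limit:
  fixes f :: "nat \<Rightarrow> complex \<Rightarrow> complex"
  assumes S: "open S" "connected S"
    and hol: "\<And>n. f n holomorphic_on S"
    and omit: "\<And>n z. z \<in> S \<Longrightarrow> f n z \<noteq> 0 \<and> f n z \<noteq> 1"
    and w: "w \<in> S" "filterlim (\<lambda>n. f n w) at_infinity sequentially"
  obtains r :: "nat \<Rightarrow> nat" where "strict_mono r"
    "\<And>z. z \<in> S \<Longrightarrow> filterlim (\<lambda>n. f (r n) z) at_infinity sequentially"
proof (rule Montel_omitting_01[OF S hol omit])
  fix r :: "nat \<Rightarrow> nat" and h
  assume r: "strict_mono r"
    and lim: "\<And>K. \<lbrakk>compact K; K \<subseteq> S\<rbrakk> \<Longrightarrow> uniform_limit K (\<lambda>n. f (r n)) h sequentially"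
  have "(\<lambda>n. f (r n) w) \<longlonglongrightarrow> h w"
    using lim[of "{w}"] w(1) by (auto intro: tendsto_uniform_limitI)
  then show thesis
    using not_tendsto_and_filterlim_at_infinity[OF trivial_limit_sequentially _
        filterlim_compose[OF w(2) filterlim_subseq[OF r]]] by blast
next
  fix r :: "nat \<Rightarrow> nat"
  assume r: "strict_mono r"
    and inf: "\<And>K M. \<lbrakk>compact K; K \<subseteq> S\<rbrakk> \<Longrightarrow> \<forall>\<^sub>F n in sequentially. \<forall>z\<in>K. M \<le> cmod (f (r n) z)"
  have "filterlim (\<lambda>n. f (r n) z) at_infinity sequentially" if "z \<in> S" for z
  proof (rule filterlim_norm_at_top_imp_at_infinity)
    show "filterlim (\<lambda>n. cmod (f (r n) z)) at_top sequentially"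
      unfolding filterlim_at_top using inf[of "{z}"] that by auto
  qed
  then show thesis using that[OF r] by blast
qed

section \<open>Periodic functions in the left half plane with zeros and 1-points on alternating
  lines\<close>

lemma Im_not_congruent:
  fixes \<alpha> y :: real and m :: int
  assumes "\<alpha> < y" "y < \<alpha> + 2 * pi"
  shows "y \<noteq> \<alpha> + 2 * pi * of_int m"
proof
  assume y: "y = \<alpha> + 2 * pi * of_int m"
  then have "0 < 2 * pi * of_int m" "2 * pi * of_int m < 2 * pi * 1"
    using assms by simp_all
  then have "0 < m" "m < 1"
    by (simp_all add: zero_less_mult_iff)
  then show False by simp
qed

text \<open>The condition \<open>Re z < 0\<close> describes the preimage of the punctured unit disk
  under exp.\<close>

definition strip :: "real \<Rightarrow> real \<Rightarrow> complex set" where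
  "strip a b = {z. Re z < 0 \<and> a < Im z \<and> Im z < b}"

lemma strip: "open (strip a b)" "connected (strip a b)"
proof -
  have eq: "strip a b = {z. Re z < 0} \<inter> {z. a < Im z} \<inter> {z. Im z < b}"
    by (auto simp: strip_def)
  show "open (strip a b)"
    unfolding eq by (intro open_Int open_halfspace_Re_lt open_halfspace_Im_gt open_halfspace_Im_lt)
  show "connected (strip a b)"
    unfolding eq by (intro convex_connected convex_Int convex_halfspace_Re_lt convex_halfspace_Im_gt convex_halfspace_Im_lt)
qed

text \<open>The two parameters run through the preimages of the rays under the exponential map.\<close>

locale line_distributed_values =
  fixes F :: "nat \<Rightarrow> complex \<Rightarrow> complex" and \<alpha> \<beta> :: real
  assumes less: "\<alpha> < \<beta>" "\<beta> < \<alpha> + 2 * pi"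
    and hol: "\<And>n. F n holomorphic_on {z. Re z < 0}"
    and periodic: "\<And>n z. F n (z + 2 * of_real pi * \<i>) = F n z"
    and zero: "\<And>n z. \<lbrakk>Re z < 0; F n z = 0\<rbrakk> \<Longrightarrow> \<exists>m::int. Im z = \<alpha> + 2 * pi * of_int m"
    and one: "\<And>n z. \<lbrakk>Re z < 0; F n z = 1\<rbrakk> \<Longrightarrow> \<exists>m::int. Im z = \<beta> + 2 * pi * of_int m"
begin

lemma nonzero: "\<lbrakk>Re z < 0; \<alpha> < Im z; Im z < \<alpha> + 2 * pi\<rbrakk> \<Longrightarrow> F n z \<noteq> 0"
  using zero Im_not_congruent by blast

lemma not_one: "\<lbrakk>Re z < 0; \<beta> - 2 * pi < Im z; Im z < \<beta>\<rbrakk> \<Longrightarrow> F n z \<noteq> 1"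
proof
  assume z: "Re z < 0" "\<beta> - 2 * pi < Im z" "Im z < \<beta>" and "F n z = 1"
  then obtain m :: int where "Im z = \<beta> + 2 * pi * of_int m" using one by blast
  then have "Im z = (\<beta> - 2 * pi) + 2 * pi * of_int (m + 1)"
    by (simp add: algebra_simps)
  then show False using Im_not_congruent[of "\<beta> - 2 * pi" "Im z" "m + 1"] z by simp
qed

lemma zero_near: "\<lbrakk>Re z < 0; F n z = 0; \<alpha> - 2 * pi < Im z; Im z < \<alpha> + 2 * pi\<rbrakk> \<Longrightarrow> Im z = \<alpha>"
proof (rule ccontr)
  assume z: "Re z < 0" "F n z = 0" "\<alpha> - 2 * pi < Im z" "Im z < \<alpha> + 2 * pi" "Im z \<noteq> \<alpha>"
  then have "Im z < \<alpha>" using nonzero[of z n] by linarith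
  then have "F n (z + 2 * of_real pi * \<i>) \<noteq> 0"
    using z by (intro nonzero) auto
  then show False using z(2) periodic by simp
qed

text \<open>This symmetry exchanges zeros and 1-points while preserving the order of the lines, so
  that every result at a zero line is available at a line of 1-points.\<close>

lemma shift: "line_distributed_values (\<lambda>n z. 1 - F n z) \<beta> (\<alpha> + 2 * pi)"
proof
  show "(\<lambda>z. 1 - F n z) holomorphic_on {z. Re z < 0}" for n
    by (intro holomorphic_intros hol)
  show "\<exists>m::int. Im z = \<beta> + 2 * pi * of_int m" if "Re z < 0" "1 - F n z = 0" for n z
    using one[of z n] that by simp
  show "\<exists>m::int. Im z = \<alpha> + 2 * pi + 2 * pi * of_int m" if z: "Re z < 0" "1 - F n z = 1" for n z
  proof -
    have "F n z = 0" using z(2) by simp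
    with zero[OF z(1)] obtain m :: int where "Im z = \<alpha> + 2 * pi * of_int m" by blast
    then show ?thesis by (intro exI[of _ "m - 1"]) (simp add: algebra_simps)
  qed
qed (use less periodic in auto)

lemma holomorphic_strip: "F n holomorphic_on strip a b"
  using hol by (rule holomorphic_on_subset) (auto simp: strip_def)

lemma omit_strip1: "z \<in> strip \<alpha> \<beta> \<Longrightarrow> F n z \<noteq> 0 \<and> F n z \<noteq> 1"
  using less by (auto simp: strip_def dest: nonzero[of z n] not_one[of z n])

lemma omit_strip2: "z \<in> strip \<beta> (\<alpha> + 2 * pi) \<Longrightarrow> F n z \<noteq> 0 \<and> F n z \<noteq> 1"
proof -
  assume z: "z \<in> strip \<beta> (\<alpha> + 2 * pi)"
  have "F n z \<noteq> 1"
    using one[of z n] Im_not_congruent[of \<beta> "Im z"] z less by (auto simp: strip_def)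
  then show ?thesis using z less nonzero[of z n] by (auto simp: strip_def)
qed

text \<open>Near the line \<open>Im z = \<beta>\<close> the limits on the two sides could only be 0 and \<open>\<infinity>\<close>.\<close>

lemma no_limits_one_infinity:
  fixes r :: "nat \<Rightarrow> nat"
  assumes S: "(S = strip \<alpha> \<beta> \<and> T = strip \<beta> (\<alpha> + 2 * pi)) \<or> (T = strip \<alpha> \<beta> \<and> S = strip \<beta> (\<alpha> + 2 * pi))"
    and lim1: "\<And>z. z \<in> S \<Longrightarrow> (\<lambda>n. F (r n) z) \<longlonglongrightarrow> 1"
    and liminf: "\<And>z. z \<in> T \<Longrightarrow> filterlim (\<lambda>n. F (r n) z) at_infinity sequentially"
  shows False
proof -
  \<comment> \<open>The disk of this radius about \<open>z0\<close> stays in the left half plane and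
    avoids the zero lines at heights \<open>\<alpha>\<close> and
    \<open>\<alpha> + 2 * pi\<close>.\<close>
  define R where "R = min 1 (min (\<beta> - \<alpha>) (\<alpha> + 2 * pi - \<beta>))"
  define z0 where "z0 = Complex (-1) \<beta>"
  have R: "0 < R" "R \<le> 1" "R \<le> \<beta> - \<alpha>" "R \<le> \<alpha> + 2 * pi - \<beta>"
    using less by (auto simp: R_def)
  have ball: "Re z < 0" "\<beta> - R < Im z" "Im z < \<beta> + R" if "z \<in> ball z0 R" for z
    using that abs_Re_le_cmod[of "z - z0"] abs_Im_le_cmod[of "z - z0"] R
    by (auto simp: z0_def dist_norm norm_minus_commute abs_le_iff)
  obtain s :: "nat \<Rightarrow> nat" where s: "strict_mono s" and dich:
    "sphere_convergent_on (ball z0 (R/16)) (\<lambda>n. F (r (s n))) \<or>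
     zero_infinity_limits {z \<in> ball z0 (R/16). Im z > Im z0} {z \<in> ball z0 (R/16). Im z < Im z0} (\<lambda>n. F (r (s n))) \<or>
     zero_infinity_limits {z \<in> ball z0 (R/16). Im z < Im z0} {z \<in> ball z0 (R/16). Im z > Im z0} (\<lambda>n. F (r (s n)))"
  proof (rule dichotomy_on_ball[OF R(1), of "\<lambda>n. F (r n)" z0])
    show "F (r n) holomorphic_on ball z0 R" for n
      using hol by (rule holomorphic_on_subset) (use ball in auto)
    show "F (r n) z \<noteq> 0" if "z \<in> ball z0 R" for n z
      using ball[OF that] R by (intro nonzero) auto
    show "Im z = Im z0" if "z \<in> ball z0 R" "F (r n) z = 1" for n z
      using line_distributed_values.zero_near[OF shift, of z "r n"] ball[OF that(1)] that(2) R less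
      by (simp add: z0_def)
  qed blast
  have lim1': "(\<lambda>n. F (r (s n)) z) \<longlonglongrightarrow> 1" if "z \<in> S" for z
    using LIMSEQ_subseq_LIMSEQ[OF lim1[OF that] s] by (simp add: o_def)
  have liminf': "filterlim (\<lambda>n. F (r (s n)) z) at_infinity sequentially" if "z \<in> T" for z
    using filterlim_compose[OF liminf[OF that] filterlim_subseq[OF s]] .
  \<comment> \<open>One point on each side of the line, at half the radius
    \<open>R/16\<close>.\<close>
  define p q where "p = Complex (-1) (\<beta> - R/32)" and "q = Complex (-1) (\<beta> + R/32)"
  have diff: "p - z0 = - (of_real (R/32) * \<i>)" "q - z0 = of_real (R/32) * \<i>"
    by (simp_all add: p_def q_def z0_def complex_eq_iff)
  have "cmod (of_real (R/32) * \<i>) = R/32"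
    using R(1) by (simp only: norm_mult norm_of_real norm_ii)
  then have "cmod (p - z0) = R/32" "cmod (q - z0) = R/32"
    by (simp_all only: diff norm_minus_cancel)
  then have pq: "p \<in> ball z0 (R/16)" "q \<in> ball z0 (R/16)"
    using R(1) by (simp_all add: dist_norm norm_minus_commute)
  have pqS: "p \<in> strip \<alpha> \<beta>" "q \<in> strip \<beta> (\<alpha> + 2 * pi)" "Im p < Im z0" "Im q > Im z0"
    using R by (auto simp: p_def q_def z0_def strip_def)
  obtain u v where uv: "u \<in> S" "v \<in> T" "{u, v} = {p, q}"
    using S pqS by blast
  have ub: "u \<in> ball z0 (R/16)" "v \<in> ball z0 (R/16)" "Im u \<noteq> Im z0"
    using uv(3) pq pqS by (auto simp: doubleton_eq_iff)
  \<comment> \<open>The limits 1 at \<open>u\<close> and \<infinity> at \<open>v\<close> exclude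
    convergence on the disk, and the limit 1 at \<open>u\<close> excludes both pairs of half-disk
    limits.\<close>
  have "\<not> sphere_convergent_on (ball z0 (R/16)) (\<lambda>n. F (r (s n)))"
    using not_sphere_convergent_on[OF ub(1) lim1'[OF uv(1)] ub(2) liminf'[OF uv(2)]] .
  moreover have "\<not> (\<lambda>n. F (r (s n)) u) \<longlonglongrightarrow> 0"
    using LIMSEQ_unique[OF lim1'[OF uv(1)], of 0] by auto
  moreover have "\<not> filterlim (\<lambda>n. F (r (s n)) u) at_infinity sequentially"
    using not_tendsto_and_filterlim_at_infinity[OF trivial_limit_sequentially lim1'[OF uv(1)]] by blast
  ultimately show False
    using dich ub unfolding zero_infinity_limits_def by (auto simp: linorder_neq_iff)
qed

text \<open>The bounds on \<open>R\<close> keep the disk in the left half plane and away from the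
  lines of 1-points at heights \<open>\<beta>\<close> and \<open>\<beta> - 2 * pi\<close>, so
  \<open>1 - F n\<close> is zero-free there and takes the value 1 on the central line only.\<close>

lemma normal_at_zero_line:
  assumes R: "0 < R" "R \<le> - Re \<zeta>" "R \<le> \<beta> - \<alpha>" "R \<le> \<alpha> + 2 * pi - \<beta>" and \<zeta>: "Im \<zeta> = \<alpha>"
  obtains r :: "nat \<Rightarrow> nat" where "strict_mono r" "sphere_convergent_on (ball \<zeta> (R/16)) (\<lambda>n. F (r n))"
proof -
  have ball: "Re z < 0" "\<alpha> - R < Im z" "Im z < \<alpha> + R" if "z \<in> ball \<zeta> R" for z
    using that abs_Re_le_cmod[of "z - \<zeta>"] abs_Im_le_cmod[of "z - \<zeta>"] R \<zeta>
    by (auto simp: dist_norm norm_minus_commute abs_le_iff)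
  have small: "z \<in> ball \<zeta> R" if "z \<in> ball \<zeta> (R/16)" for z
    using that R(1) by simp
  obtain r :: "nat \<Rightarrow> nat" where r: "strict_mono r" and dich:
    "sphere_convergent_on (ball \<zeta> (R/16)) (\<lambda>n z. 1 - F (r n) z) \<or>
     zero_infinity_limits {z \<in> ball \<zeta> (R/16). Im z > Im \<zeta>} {z \<in> ball \<zeta> (R/16). Im z < Im \<zeta>} (\<lambda>n z. 1 - F (r n) z) \<or>
     zero_infinity_limits {z \<in> ball \<zeta> (R/16). Im z < Im \<zeta>} {z \<in> ball \<zeta> (R/16). Im z > Im \<zeta>} (\<lambda>n z. 1 - F (r n) z)"
  proof (rule dichotomy_on_ball[OF R(1), of "\<lambda>n z. 1 - F n z" \<zeta>])
    show "(\<lambda>z. 1 - F n z) holomorphic_on ball \<zeta> R" for n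
      by (intro holomorphic_intros holomorphic_on_subset[OF hol]) (use ball in auto)
    show "1 - F n z \<noteq> 0" if "z \<in> ball \<zeta> R" for n z
      using not_one[of z n] ball[OF that] R by auto
    show "Im z = Im \<zeta>" if "z \<in> ball \<zeta> R" "1 - F n z = 1" for n z
      using zero_near[of z n] ball[OF that(1)] that(2) R less \<zeta> by auto
  qed blast
  define S1 S2 where "S1 = strip \<alpha> \<beta>" and "S2 = strip \<beta> (\<alpha> + 2 * pi)"
  \<comment> \<open>The half disk below the zero line is moved up by one period. It then lies in the
    strip above \<open>Im z = \<beta>\<close>, with the same values of \<open>F n\<close>.\<close>
  define W1 W2 where "W1 = {z \<in> ball \<zeta> (R/16). Im z > Im \<zeta>}" and
    "W2 = (\<lambda>z. z + 2 * of_real pi * \<i>) ` {z \<in> ball \<zeta> (R/16). Im z < Im \<zeta>}"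
  have W1: "open W1" "W1 \<noteq> {}" "W1 \<subseteq> S1"
  proof -
    have "W1 = ball \<zeta> (R/16) \<inter> {z. Im \<zeta> < Im z}" by (auto simp: W1_def)
    then show "open W1" by (simp add: open_Int open_halfspace_Im_gt)
    have "\<zeta> + of_real (R/32) * \<i> \<in> W1"
      using R(1) by (simp add: W1_def dist_norm norm_mult)
    then show "W1 \<noteq> {}" by blast
    show "W1 \<subseteq> S1"
      using ball small R \<zeta> by (fastforce simp: W1_def S1_def strip_def)
  qed
  have W2: "open W2" "W2 \<noteq> {}" "W2 \<subseteq> S2"
  proof -
    have "{z \<in> ball \<zeta> (R/16). Im z < Im \<zeta>} = ball \<zeta> (R/16) \<inter> {z. Im z < Im \<zeta>}" by auto
    then have "open {z \<in> ball \<zeta> (R/16). Im z < Im \<zeta>}" by (simp add: open_Int open_halfspace_Im_lt)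
    from open_translation[OF this, of "2 * of_real pi * \<i>"] show "open W2"
      by (simp add: W2_def add.commute)
    have "\<zeta> - of_real (R/32) * \<i> \<in> {z \<in> ball \<zeta> (R/16). Im z < Im \<zeta>}"
      using R(1) by (simp add: dist_norm norm_mult)
    then show "W2 \<noteq> {}" unfolding W2_def by blast
    show "W2 \<subseteq> S2"
    proof
      fix w assume "w \<in> W2"
      then obtain z where z: "w = z + 2 * of_real pi * \<i>" "z \<in> ball \<zeta> (R/16)" "Im z < Im \<zeta>"
        by (auto simp: W2_def)
      show "w \<in> S2"
        using ball[OF small[OF z(2)]] z(1,3) R \<zeta> by (auto simp: S2_def strip_def)
    qed
  qed
  have W_lim: "(\<lambda>n. F (r n) z) \<longlonglongrightarrow> 1" if "(\<lambda>n. 1 - F (r n) z) \<longlonglongrightarrow> 0" for z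
    using tendsto_diff[OF tendsto_const[of 1] that] by simp
  have W_inf: "filterlim (\<lambda>n. F (r n) z) at_infinity sequentially"
    if "filterlim (\<lambda>n. 1 - F (r n) z) at_infinity sequentially" for z
  proof -
    have "filterlim (\<lambda>n. - (1 - F (r n) z)) at_infinity sequentially"
      using that filterlim_at_infinity_imp_norm_at_top[OF that]
      by (intro filterlim_norm_at_top_imp_at_infinity) (simp only: norm_minus_cancel)
    from tendsto_add_filterlim_at_infinity[OF tendsto_const[of 1] this] show ?thesis by simp
  qed
  \<comment> \<open>Both assignments of the limits to the strips are treated at once. The limit 1
    needs the open set \<open>WA\<close> for the identity theorem, the limit \<infinity> only one
    point of \<open>WB\<close>.\<close>
  have contra: False
    if A: "A = S1 \<and> B = S2 \<or> B = S1 \<and> A = S2"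
      and WA: "open WA" "WA \<noteq> {}" "WA \<subseteq> A" "\<And>z. z \<in> WA \<Longrightarrow> (\<lambda>n. F (r n) z) \<longlonglongrightarrow> 1"
      and WB: "WB \<noteq> {}" "WB \<subseteq> B" "\<And>z. z \<in> WB \<Longrightarrow> filterlim (\<lambda>n. F (r n) z) at_infinity sequentially"
    for A B WA WB
  proof -
    have AB: "open A" "connected A" "open B" "connected B"
      "\<And>n. F n holomorphic_on A" "\<And>n. F n holomorphic_on B"
      "\<And>n z. z \<in> A \<Longrightarrow> F n z \<noteq> 0 \<and> F n z \<noteq> 1" "\<And>n z. z \<in> B \<Longrightarrow> F n z \<noteq> 0 \<and> F n z \<noteq> 1"
      using A strip holomorphic_strip omit_strip1 omit_strip2 by (auto simp: S1_def S2_def)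
    obtain s :: "nat \<Rightarrow> nat" where s: "strict_mono s" "\<And>z. z \<in> A \<Longrightarrow> (\<lambda>n. F (r (s n)) z) \<longlonglongrightarrow> 1"
      using propagate_finite_limit[where f = "\<lambda>n. F (r n)", OF AB(1,2) AB(5) AB(7) WA] by blast
    obtain w where w: "w \<in> WB" using WB(1) by blast
    have wlim: "filterlim (\<lambda>n. F (r (s n)) w) at_infinity sequentially"
      using filterlim_compose[OF WB(3)[OF w] filterlim_subseq[OF s(1)]] .
    obtain t :: "nat \<Rightarrow> nat" where t: "strict_mono t"
        "\<And>z. z \<in> B \<Longrightarrow> filterlim (\<lambda>n. F (r (s (t n))) z) at_infinity sequentially"
      using propagate_infinite_limit[where f = "\<lambda>n. F (r (s n))", OF AB(3,4) AB(6) AB(8) subsetD[OF WB(2) w] wlim]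
      by blast
    show False
    proof (rule no_limits_one_infinity[of A B "\<lambda>n. r (s (t n))"])
      show "(\<lambda>n. F (r (s (t n))) z) \<longlonglongrightarrow> 1" if "z \<in> A" for z
        using LIMSEQ_subseq_LIMSEQ[OF s(2)[OF that] t(1)] by (simp add: o_def)
    qed (use A t(2) in \<open>auto simp: S1_def S2_def\<close>)
  qed
  have "\<not> zero_infinity_limits {z \<in> ball \<zeta> (R/16). Im z > Im \<zeta>} {z \<in> ball \<zeta> (R/16). Im z < Im \<zeta>} (\<lambda>n z. 1 - F (r n) z)"
  proof
    assume *: "zero_infinity_limits {z \<in> ball \<zeta> (R/16). Im z > Im \<zeta>} {z \<in> ball \<zeta> (R/16). Im z < Im \<zeta>} (\<lambda>n z. 1 - F (r n) z)"
    show False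
    proof (rule contra[of S1 S2 W1 W2])
      show "(\<lambda>n. F (r n) z) \<longlonglongrightarrow> 1" if "z \<in> W1" for z
        using * that by (intro W_lim) (auto simp: zero_infinity_limits_def W1_def)
      show "filterlim (\<lambda>n. F (r n) z) at_infinity sequentially" if "z \<in> W2" for z
        using * that by (intro W_inf) (auto simp: zero_infinity_limits_def W2_def periodic)
    qed (use W1 W2 in auto)
  qed
  moreover have "\<not> zero_infinity_limits {z \<in> ball \<zeta> (R/16). Im z < Im \<zeta>} {z \<in> ball \<zeta> (R/16). Im z > Im \<zeta>} (\<lambda>n z. 1 - F (r n) z)"
  proof
    assume *: "zero_infinity_limits {z \<in> ball \<zeta> (R/16). Im z < Im \<zeta>} {z \<in> ball \<zeta> (R/16). Im z > Im \<zeta>} (\<lambda>n z. 1 - F (r n) z)"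
    show False
    proof (rule contra[of S2 S1 W2 W1])
      show "(\<lambda>n. F (r n) z) \<longlonglongrightarrow> 1" if "z \<in> W2" for z
        using * that by (intro W_lim) (auto simp: zero_infinity_limits_def W2_def periodic)
      show "filterlim (\<lambda>n. F (r n) z) at_infinity sequentially" if "z \<in> W1" for z
        using * that by (intro W_inf) (auto simp: zero_infinity_limits_def W1_def)
    qed (use W1 W2 in auto)
  qed
  ultimately have "sphere_convergent_on (ball \<zeta> (R/16)) (\<lambda>n z. 1 - F (r n) z)"
    using dich by blast
  then show ?thesis
    using that[OF r] sphere_convergent_on_one_minus[of _ "\<lambda>n. F (r n)"] by blast
qed

lemma normal_in_strip:
  assumes R: "0 < R" "cball \<zeta> R \<subseteq> strip \<alpha> \<beta> \<or> cball \<zeta> R \<subseteq> strip \<beta> (\<alpha> + 2 * pi)"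
  obtains r :: "nat \<Rightarrow> nat" where "strict_mono r" "sphere_convergent_on (ball \<zeta> R) (\<lambda>n. F (r n))"
proof -
  obtain S where S: "S = strip \<alpha> \<beta> \<or> S = strip \<beta> (\<alpha> + 2 * pi)" "cball \<zeta> R \<subseteq> S"
    using R by blast
  then have S': "open S" "connected S" "\<And>n. F n holomorphic_on S" "\<And>n z. z \<in> S \<Longrightarrow> F n z \<noteq> 0 \<and> F n z \<noteq> 1"
    using strip holomorphic_strip omit_strip1 omit_strip2 by auto
  show ?thesis
  proof (rule Montel_omitting_01[OF S'])
    fix r h
    assume r: "strict_mono r" and
      lim: "\<And>K. \<lbrakk>compact K; K \<subseteq> S\<rbrakk> \<Longrightarrow> uniform_limit K (\<lambda>n. F (r n)) h sequentially"
    have "uniform_limit (ball \<zeta> R) (\<lambda>n. F (r n)) h sequentially"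
      by (rule uniform_limit_on_subset[OF lim[OF compact_cball S(2)]]) simp
    then show thesis
      using that[OF r] by (simp add: uniform_limit_imp_sphere_convergent)
  next
    fix r :: "nat \<Rightarrow> nat"
    assume r: "strict_mono r" and
      inf: "\<And>K M. \<lbrakk>compact K; K \<subseteq> S\<rbrakk> \<Longrightarrow> \<forall>\<^sub>F n in sequentially. \<forall>z\<in>K. M \<le> cmod (F (r n) z)"
    have "\<forall>\<^sub>F n in sequentially. \<forall>z\<in>ball \<zeta> R. M \<le> cmod (F (r n) z)" for M
      using inf[OF compact_cball S(2), of M] by eventually_elim auto
    then show thesis
      using that[OF r] by (simp add: sphere_convergent_on_def)
  qed
qed

end

section \<open>Values on rays\<close>

lemma Im_exp_in_ray:
  assumes "c \<noteq> 0" "exp \<zeta> \<in> {t *\<^sub>R c |t. t \<ge> 0}"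
  shows "\<exists>m::int. Im \<zeta> = Arg c + 2 * pi * of_int m"
proof -
  obtain t where t: "exp \<zeta> = t *\<^sub>R c" "t \<ge> 0" using assms(2) by blast
  \<comment> \<open>The origin belongs to the ray but is not a value of exp.\<close>
  then have "t > 0" by (cases "t = 0") auto
  then have "Arg (exp \<zeta>) = Arg c"
    using t(1) by (simp add: scaleR_conv_of_real Arg_times_of_real)
  moreover have "exp \<zeta> = exp (Ln (exp \<zeta>))" by simp
  then obtain m :: int where "\<zeta> = Ln (exp \<zeta>) + of_real (of_int (2 * m) * pi) * \<i>"
    unfolding exp_eq by blast
  then have "Im \<zeta> = Im (Ln (exp \<zeta>)) + 2 * pi * of_int m"
    by (subst (asm) complex_eq_iff) simp
  ultimately show ?thesis
    by (auto simp: Arg_def)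
qed

text \<open>The generator of a ray is determined only up to a positive factor, its argument
  uniquely; hence distinct rays have generators with distinct arguments.\<close>

lemma ray_eq_Arg:
  assumes "c \<noteq> 0"
  shows "{t *\<^sub>R c |t. t \<ge> 0} = {t *\<^sub>R cis (Arg c) |t. t \<ge> 0}"
proof -
  have c: "c = cmod c *\<^sub>R cis (Arg c)"
    using rcis_cmod_Arg[of c] by (simp add: rcis_def scaleR_conv_of_real)
  have "\<exists>s\<ge>0. t *\<^sub>R c = s *\<^sub>R cis (Arg c)" if "t \<ge> 0" for t
    using that c by (intro exI[of _ "t * cmod c"]) (metis mult_nonneg_nonneg norm_ge_zero scaleR_scaleR)
  moreover have "\<exists>s\<ge>0. t *\<^sub>R cis (Arg c) = s *\<^sub>R c" if "t \<ge> 0" for t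
  proof (intro exI[of _ "t / cmod c"] conjI)
    have "(t / cmod c) *\<^sub>R c = (t / cmod c) *\<^sub>R (cmod c *\<^sub>R cis (Arg c))" using c by simp
    then show "t *\<^sub>R cis (Arg c) = (t / cmod c) *\<^sub>R c" using assms by simp
  qed (use that in simp)
  ultimately show ?thesis by blast
qed

lemma exp_preimage_in_period:
  assumes "z \<noteq> 0" "- pi < \<alpha>" "\<alpha> \<le> pi"
  obtains \<zeta> where "exp \<zeta> = z" "\<alpha> \<le> Im \<zeta>" "Im \<zeta> < \<alpha> + 2 * pi"
proof (cases "\<alpha> \<le> Im (Ln z)")
  case True
  then show ?thesis
    using assms Im_Ln_le_pi[of z] by (intro that[of "Ln z"]) auto
next
  case False
  then show ?thesis
    using assms mpi_less_Im_Ln[of z] by (intro that[of "Ln z + 2 * of_real pi * \<i>"]) (auto simp: exp_add)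
qed

lemma open_exp_image: "open U \<Longrightarrow> open (exp ` U :: complex set)"
proof (rule open_mapping_thm[of exp UNIV])
  show "\<not> (exp :: complex \<Rightarrow> complex) constant_on UNIV"
  proof
    assume "(exp :: complex \<Rightarrow> complex) constant_on UNIV"
    then obtain y :: complex where y: "\<And>x. exp x = y"
      by (auto simp: constant_on_def)
    have "exp (of_real pi * \<i>) = exp (0 :: complex)"
      by (simp only: y)
    then show False by simp
  qed
qed (auto intro: holomorphic_intros)

lemma line_distributed_values_exp:
  fixes f :: "nat \<Rightarrow> complex \<Rightarrow> complex"
  assumes "c\<^sub>0 \<noteq> 0" "c\<^sub>1 \<noteq> 0" and ab: "Arg c\<^sub>0 < \<beta>" "\<beta> < Arg c\<^sub>0 + 2 * pi" "\<beta> = Arg c\<^sub>1 + 2 * pi * of_int l"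
    and hol: "\<And>n. f n holomorphic_on ball 0 1"
    and zero: "\<And>n z. \<lbrakk>z \<in> ball 0 1; f n z = 0\<rbrakk> \<Longrightarrow> z \<in> {t *\<^sub>R c\<^sub>0 |t. t \<ge> 0}"
    and one: "\<And>n z. \<lbrakk>z \<in> ball 0 1; f n z = 1\<rbrakk> \<Longrightarrow> z \<in> {t *\<^sub>R c\<^sub>1 |t. t \<ge> 0}"
  shows "line_distributed_values (\<lambda>n \<zeta>. f n (exp \<zeta>)) (Arg c\<^sub>0) \<beta>"
proof
  show "(\<lambda>\<zeta>. f n (exp \<zeta>)) holomorphic_on {z. Re z < 0}" for n
    by (intro holomorphic_on_compose_gen[OF _ hol, unfolded o_def] holomorphic_intros) auto
  show "f n (exp (z + 2 * of_real pi * \<i>)) = f n (exp z)" for n z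
    by (simp add: exp_add)
  show "\<exists>m::int. Im z = Arg c\<^sub>0 + 2 * pi * of_int m" if "Re z < 0" "f n (exp z) = 0" for n z
    using zero[of "exp z" n] that assms(1) by (intro Im_exp_in_ray) auto
  show "\<exists>m::int. Im z = \<beta> + 2 * pi * of_int m" if z: "Re z < 0" "f n (exp z) = 1" for n z
  proof -
    have "exp z \<in> {t *\<^sub>R c\<^sub>1 |t. t \<ge> 0}" using z by (intro one[of _ n]) auto
    from Im_exp_in_ray[OF assms(2) this] obtain m :: int where "Im z = Arg c\<^sub>1 + 2 * pi * of_int m" by blast
    then show ?thesis
      using ab(3) by (intro exI[of _ "m - l"]) (simp add: algebra_simps)
  qed
qed (fact ab)+

text \<open>\<open>\<rho>\<close> is obtained before \<open>F\<close>: the neighbourhood depends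
  only on the lines and on \<open>\<zeta>\<close>, as required for passing from local to global
  normality.\<close>

lemma line_distributed_values_locally_normal:
  assumes ab: "\<alpha> < \<beta>" "\<beta> < \<alpha> + 2 * pi" and \<zeta>: "Re \<zeta> < 0" "\<alpha> \<le> Im \<zeta>" "Im \<zeta> < \<alpha> + 2 * pi"
  obtains \<rho> where "\<rho> > 0"
    "\<And>F. line_distributed_values F \<alpha> \<beta> \<Longrightarrow>
       \<exists>r :: nat \<Rightarrow> nat. strict_mono r \<and> sphere_convergent_on (ball \<zeta> \<rho>) (\<lambda>n. F (r n))"
proof -
  define R where "R = min (- Re \<zeta>) (min (\<beta> - \<alpha>) (\<alpha> + 2 * pi - \<beta>))"
  have R: "0 < R" "R \<le> - Re \<zeta>" "R \<le> \<beta> - \<alpha>" "R \<le> \<alpha> + 2 * pi - \<beta>"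
    using ab \<zeta> by (auto simp: R_def)
  consider "Im \<zeta> = \<alpha>" | "Im \<zeta> = \<beta>" | "Im \<zeta> \<noteq> \<alpha>" "Im \<zeta> \<noteq> \<beta>" by blast
  then show ?thesis
  proof cases
    case 1
    show ?thesis
    proof (rule that[of "R/16"])
      fix F assume "line_distributed_values F \<alpha> \<beta>"
      then interpret line_distributed_values F \<alpha> \<beta> .
      show "\<exists>r :: nat \<Rightarrow> nat. strict_mono r \<and> sphere_convergent_on (ball \<zeta> (R/16)) (\<lambda>n. F (r n))"
        using normal_at_zero_line[OF R 1] by blast
    qed (use R in simp)
  next
    case 2
    show ?thesis
    proof (rule that[of "R/16"])
      fix F assume "line_distributed_values F \<alpha> \<beta>"
      then interpret line_distributed_values F \<alpha> \<beta> .
      \<comment> \<open>For \<open>1 - F n\<close> the line through \<open>\<zeta>\<close> is a zero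
        line, and the two bounds on \<open>R\<close> merely change places.\<close>
      interpret shifted: line_distributed_values "\<lambda>n z. 1 - F n z" \<beta> "\<alpha> + 2 * pi"
        by (rule shift)
      have R': "R \<le> (\<alpha> + 2 * pi) - \<beta>" "R \<le> \<beta> + 2 * pi - (\<alpha> + 2 * pi)" using R by auto
      obtain r :: "nat \<Rightarrow> nat" where "strict_mono r" "sphere_convergent_on (ball \<zeta> (R/16)) (\<lambda>n z. 1 - F (r n) z)"
        using shifted.normal_at_zero_line[OF R(1,2) R' 2] by blast
      then show "\<exists>r :: nat \<Rightarrow> nat. strict_mono r \<and> sphere_convergent_on (ball \<zeta> (R/16)) (\<lambda>n. F (r n))"
        using sphere_convergent_on_one_minus[of _ "\<lambda>n. F (r n)"] by blast
    qed (use R in simp)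
  next
    case 3
    have "\<zeta> \<in> strip \<alpha> \<beta> \<or> \<zeta> \<in> strip \<beta> (\<alpha> + 2 * pi)"
      using 3 \<zeta> by (auto simp: strip_def)
    then obtain \<rho> where \<rho>: "\<rho> > 0" "cball \<zeta> \<rho> \<subseteq> strip \<alpha> \<beta> \<or> cball \<zeta> \<rho> \<subseteq> strip \<beta> (\<alpha> + 2 * pi)"
      by (meson strip(1) open_contains_cball)
    show ?thesis
    proof (rule that[OF \<rho>(1)])
      fix F assume "line_distributed_values F \<alpha> \<beta>"
      then interpret line_distributed_values F \<alpha> \<beta> .
      show "\<exists>r :: nat \<Rightarrow> nat. strict_mono r \<and> sphere_convergent_on (ball \<zeta> \<rho>) (\<lambda>n. F (r n))"
        using normal_in_strip[OF \<rho>] by blast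
    qed
  qed
qed

theorem theorem1p1:
  fixes L\<^sub>0 L\<^sub>1 :: "complex set"
  assumes "ray_from_origin L\<^sub>0" and "ray_from_origin L\<^sub>1" and "L\<^sub>0 \<noteq> L\<^sub>1"
  shows "normal_family_on (ball 0 1 - {0})
    {f. f holomorphic_on ball 0 1 \<and>
        (\<forall>z\<in>ball 0 1. f z = 0 \<longrightarrow> z \<in> L\<^sub>0) \<and>
        (\<forall>z\<in>ball 0 1. f z = 1 \<longrightarrow> z \<in> L\<^sub>1)}"
proof -
  obtain c\<^sub>0 where c\<^sub>0: "c\<^sub>0 \<noteq> 0" "L\<^sub>0 = {t *\<^sub>R c\<^sub>0 |t. t \<ge> 0}"
    using assms(1) unfolding ray_from_origin_def by blast
  obtain c\<^sub>1 where c\<^sub>1: "c\<^sub>1 \<noteq> 0" "L\<^sub>1 = {t *\<^sub>R c\<^sub>1 |t. t \<ge> 0}"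
    using assms(2) unfolding ray_from_origin_def by blast
  define \<alpha> where "\<alpha> = Arg c\<^sub>0"
  have "Arg c\<^sub>0 \<noteq> Arg c\<^sub>1"
  proof
    assume eq: "Arg c\<^sub>0 = Arg c\<^sub>1"
    have "L\<^sub>0 = L\<^sub>1"
      unfolding c\<^sub>0(2) c\<^sub>1(2) ray_eq_Arg[OF c\<^sub>0(1)] ray_eq_Arg[OF c\<^sub>1(1)] eq ..
    with assms(3) show False ..
  qed
  moreover have bnd: "- pi < Arg c\<^sub>0" "Arg c\<^sub>0 \<le> pi" "- pi < Arg c\<^sub>1" "Arg c\<^sub>1 \<le> pi"
    using Arg_bounded by blast+
  \<comment> \<open>\<open>l\<close> is 0 or 1 according to the order of the two arguments; it moves
    the argument of the second ray into the open period interval above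
    \<open>\<alpha>\<close>.\<close>
  ultimately obtain l :: int where
    ab: "\<alpha> < Arg c\<^sub>1 + 2 * pi * of_int l" "Arg c\<^sub>1 + 2 * pi * of_int l < \<alpha> + 2 * pi"
    using that[of 0] that[of 1] unfolding \<alpha>_def by (cases "Arg c\<^sub>0 < Arg c\<^sub>1") auto
  show ?thesis
  proof (rule normal_family_on_local)
    fix z :: complex assume z: "z \<in> ball 0 1 - {0}"
    obtain \<zeta> where \<zeta>: "exp \<zeta> = z" "\<alpha> \<le> Im \<zeta>" "Im \<zeta> < \<alpha> + 2 * pi"
    proof (rule exp_preimage_in_period[of z \<alpha>])
      show "z \<noteq> 0" "- pi < \<alpha>" "\<alpha> \<le> pi" using z bnd by (simp_all add: \<alpha>_def)
    qed
    have "Re \<zeta> < 0"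
      using z by (simp flip: \<zeta>(1))
    then obtain \<rho> where \<rho>: "\<rho> > 0" "\<And>F. line_distributed_values F \<alpha> (Arg c\<^sub>1 + 2 * pi * of_int l) \<Longrightarrow>
       \<exists>r :: nat \<Rightarrow> nat. strict_mono r \<and> sphere_convergent_on (ball \<zeta> \<rho>) (\<lambda>n. F (r n))"
      using line_distributed_values_locally_normal[OF ab _ \<zeta>(2,3)] by blast
    show "\<exists>V. open V \<and> z \<in> V \<and>
      (\<forall>f :: nat \<Rightarrow> complex \<Rightarrow> complex.
        (\<forall>n. f n \<in> {f. f holomorphic_on ball 0 1 \<and>
            (\<forall>z\<in>ball 0 1. f z = 0 \<longrightarrow> z \<in> L\<^sub>0) \<and> (\<forall>z\<in>ball 0 1. f z = 1 \<longrightarrow> z \<in> L\<^sub>1)}) \<longrightarrow>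
        (\<exists>r :: nat \<Rightarrow> nat. strict_mono r \<and> sphere_convergent_on V (\<lambda>n. f (r n))))"
    \<comment> \<open>By the open mapping theorem this image is a neighbourhood of \<open>z\<close>,
      and it is independent of the sequence \<open>f\<close>.\<close>
    proof (intro exI[of _ "exp ` ball \<zeta> \<rho>"] conjI allI impI)
      show "open (exp ` ball \<zeta> \<rho>)" by (simp add: open_exp_image)
      show "z \<in> exp ` ball \<zeta> \<rho>" using \<zeta>(1) \<rho>(1) by auto
      fix f :: "nat \<Rightarrow> complex \<Rightarrow> complex"
      assume f: "\<forall>n. f n \<in> {f. f holomorphic_on ball 0 1 \<and>
            (\<forall>z\<in>ball 0 1. f z = 0 \<longrightarrow> z \<in> L\<^sub>0) \<and> (\<forall>z\<in>ball 0 1. f z = 1 \<longrightarrow> z \<in> L\<^sub>1)}"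
      have "line_distributed_values (\<lambda>n \<zeta>. f n (exp \<zeta>)) \<alpha> (Arg c\<^sub>1 + 2 * pi * of_int l)"
        unfolding \<alpha>_def
        by (rule line_distributed_values_exp[OF c\<^sub>0(1) c\<^sub>1(1) _ _ refl])
           (use ab f c\<^sub>0(2) c\<^sub>1(2) in \<open>auto simp: \<alpha>_def\<close>)
      from \<rho>(2)[OF this] obtain r :: "nat \<Rightarrow> nat" where "strict_mono r"
        "sphere_convergent_on (ball \<zeta> \<rho>) (\<lambda>n \<zeta>. f (r n) (exp \<zeta>))" by blast
      then show "\<exists>r :: nat \<Rightarrow> nat. strict_mono r \<and> sphere_convergent_on (exp ` ball \<zeta> \<rho>) (\<lambda>n. f (r n))"
        using sphere_convergent_on_image[of "ball \<zeta> \<rho>" "\<lambda>n. f (r n)" exp] by blast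
    qed
  qed
qed

end
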